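(* Let $\boldsymbol{m}=(m_1,m_2)\in\mathbb{N}^2$, $\boldsymbol{\lambda}=(\lambda_1,\ldots,\lambda_{m_1+m_2})\in(\mathbb{C}^* )^{m_1+m_2}$, $\boldsymbol{\sigma}=(\sigma_1,\ldots,\sigma_{m_1+m_2})\in(\mathbb{C}^* )^{m_1+m_2}$, $\boldsymbol{\eta}=(\eta_1,\ldots,\eta_{m_1+m_2})\in\mathbb{C}^{m_1+m_2}$, and let $V$ be an arbitrary simple restricted $\mathcal{G}$-module, where $\mathcal{G}$ is the planar Galilean conformal algebra. Then the tensor product $\mathcal{G}$-module $$\boldsymbol{T}(\boldsymbol{m},\boldsymbol{\lambda},\boldsymbol{\sigma},\boldsymbol{\eta},V)=\left(\bigotimes_{k=1}^{m_1}\Omega(\lambda_k,\sigma_k,\eta_k)\right)\otimes\left(\bigotimes_{k=m_1+1}^{m_1+m_2}\Gamma(\lambda_k,\sigma_k,\eta_k)\right)\otimes V$$ is simple if and only if $\lambda_1,\lambda_2,\ldots,\lambda_{m_1+m_2}$ are pairwise distinct.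
   Context: $\mathbb{N}$ is the set of non-negative integers and $\mathbb{C}^*$ the set of non-zero complex numbers. All tensor products are over $\mathbb{C}$. The planar Galilean conformal algebra $\mathcal{G}$ is the complex Lie algebra with basis $\{L_n,H_n,I_n,J_n\mid n\in\mathbb{Z}\}$ and non-trivial brackets $$[L_m,L_n]=(n-m)L_{m+n},\quad [L_m,H_n]=nH_{m+n},\quad [L_m,I_n]=(n-m)I_{m+n},$$ $$[L_m,J_n]=(n-m)J_{m+n},\quad [H_m,I_n]=I_{m+n},\quad [H_m,J_n]=-J_{m+n}$$ (all other brackets of basis elements, apart from those obtained by antisymmetry, are zero). It is $\mathbb{Z}$-graded with $\mathcal{G}_n=\mathbb{C}L_n\oplus\mathbb{C}H_n\oplus\mathbb{C}I_n\oplus\mathbb{C}J_n$. A $\mathcal{G}$-module $V$ is restricted if for every $v\in V$ there is $i\in\mathbb{N}$ such that $\mathcal{G}_nv=0$ for all $n\ge i$. For $\eta\in\mathbb{C}$ and $\lambda,\sigma\in\mathbb{C}^*$, the $\mathcal{G}$-module $\Omega(\lambda,\sigma,\eta)$ is the vector space $\mathbb{C}[s,t]$ with actions, for $n\in\mathbb{Z}$ and $f\in\mathbb{C}[s,t]$, $$L_nf(s,t)=\lambda^n(s-nt+n\eta)f(s-n,t),\quad H_nf(s,t)=\lambda^n t f(s-n,t),\quad I_nf(s,t)=\lambda^n\sigma f(s-n,t-1),\quad J_nf(s,t)=0.$$ The $\mathcal{G}$-module $\Gamma(\lambda,\sigma,\eta)$ is the vector space $\mathbb{C}[x,y]$ with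 actions, for $n\in\mathbb{Z}$ and $g\in\mathbb{C}[x,y]$, $$L_ng(x,y)=\lambda^n(x+ny+n\eta)g(x-n,y),\quad H_ng(x,y)=\lambda^n y g(x-n,y),\quad I_ng(x,y)=0,\quad J_ng(x,y)=\lambda^n\sigma g(x-n,y+1).$$ The tensor product of Lie algebra modules carries the usual action $x(m_1\otimes\cdots\otimes m_r)=\sum_{i}m_1\otimes\cdots\otimes(xm_i)\otimes\cdots\otimes m_r$; if $m_1=0$ or $m_2=0$ the corresponding factors are absent. *)

theory Defs
  imports "HOL-Computational_Algebra.Computational_Algebra" "HOL-Library.Poly_Mapping"
begin

section \<open>Complex vector spaces\<close>

class complex_vector = ab_group_add +
  fixes scaleC :: "complex \<Rightarrow> 'a \<Rightarrow> 'a"  (infixr \<open>*\<^sub>C\<close> 75)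
  assumes scaleC_add_right: "a *\<^sub>C (x + y) = a *\<^sub>C x + a *\<^sub>C y"
    and scaleC_add_left: "(a + b) *\<^sub>C x = a *\<^sub>C x + b *\<^sub>C x"
    and scaleC_scaleC: "a *\<^sub>C (b *\<^sub>C x) = (a * b) *\<^sub>C x"
    and scaleC_one: "1 *\<^sub>C x = x"

global_interpretation cvs: vector_space "scaleC :: complex \<Rightarrow> 'a \<Rightarrow> 'a::complex_vector"
  by unfold_locales (simp_all add: scaleC_add_right scaleC_add_left scaleC_scaleC scaleC_one)

instantiation complex :: complex_vector
begin
definition scaleC_complex :: "complex \<Rightarrow> complex \<Rightarrow> complex" where
  "scaleC_complex c z = c * z"
instance by standard (simp_all add: scaleC_complex_def algebra_simps)
end

instantiation poly :: (complex_vector) complex_vector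
begin
lift_definition scaleC_poly :: "complex \<Rightarrow> 'a poly \<Rightarrow> 'a poly" is "\<lambda>c p n. c *\<^sub>C p n"
  by (erule MOST_mono) simp
instance
proof
  fix x y :: "'a poly" and a b :: complex
  show "a *\<^sub>C (x + y) = a *\<^sub>C x + a *\<^sub>C y"
    by (simp add: poly_eq_iff scaleC_poly.rep_eq scaleC_add_right)
  show "(a + b) *\<^sub>C x = a *\<^sub>C x + b *\<^sub>C x"
    by (simp add: poly_eq_iff scaleC_poly.rep_eq scaleC_add_left)
  show "a *\<^sub>C b *\<^sub>C x = (a * b) *\<^sub>C x"
    by (simp add: poly_eq_iff scaleC_poly.rep_eq scaleC_scaleC)
  show "1 *\<^sub>C x = x"
    by (simp add: poly_eq_iff scaleC_poly.rep_eq scaleC_one)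
qed
end

instantiation poly_mapping :: (type, complex_vector) complex_vector
begin
lift_definition scaleC_poly_mapping ::
  "complex \<Rightarrow> ('a \<Rightarrow>\<^sub>0 'b) \<Rightarrow> ('a \<Rightarrow>\<^sub>0 'b)" is "\<lambda>c f k. c *\<^sub>C f k"
  proof -
  fix c :: complex and f :: "'a \<Rightarrow> 'b"
  assume "finite {k. f k \<noteq> 0}"
  then show "finite {k. c *\<^sub>C f k \<noteq> 0}"
    by (rule rev_finite_subset) auto
qed
instance
proof
  fix x y :: "'a \<Rightarrow>\<^sub>0 'b" and a b :: complex
  show "a *\<^sub>C (x + y) = a *\<^sub>C x + a *\<^sub>C y"
    by transfer (simp add: scaleC_add_right)
  show "(a + b) *\<^sub>C x = a *\<^sub>C x + b *\<^sub>C x"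
    by transfer (simp add: scaleC_add_left)
  show "a *\<^sub>C b *\<^sub>C x = (a * b) *\<^sub>C x"
    by transfer (simp add: scaleC_scaleC)
  show "1 *\<^sub>C x = x"
    by transfer (simp add: scaleC_one)
qed
end

text \<open>
  \<open>'b \<Rightarrow>\<^sub>0 complex\<close> is the complex vector space with basis \<open>'b\<close>; the basis vector
  belonging to \<open>b\<close> is \<open>basis_vec b\<close>, and \<open>lin_ext f\<close> is the linear extension of \<open>f\<close>.
\<close>

definition basis_vec :: "'b \<Rightarrow> ('b \<Rightarrow>\<^sub>0 complex)" where
  "basis_vec b = Poly_Mapping.single b 1"

definition lin_ext :: "('b \<Rightarrow> 'w::complex_vector) \<Rightarrow> ('b \<Rightarrow>\<^sub>0 complex) \<Rightarrow> 'w" where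
  "lin_ext f x = (\<Sum>b\<in>Poly_Mapping.keys x. Poly_Mapping.lookup x b *\<^sub>C f b)"

definition linearC :: "('v::complex_vector \<Rightarrow> 'w::complex_vector) \<Rightarrow> bool" where
  "linearC f \<longleftrightarrow> (\<forall>v w. f (v + w) = f v + f w) \<and> (\<forall>c v. f (c *\<^sub>C v) = c *\<^sub>C f v)"

lemma lookup_scaleC: "Poly_Mapping.lookup (c *\<^sub>C x) b = c *\<^sub>C Poly_Mapping.lookup x b"
  by (simp add: scaleC_poly_mapping.rep_eq)

lemma lin_ext_superset:
  assumes "finite A" "Poly_Mapping.keys x \<subseteq> A"
  shows "lin_ext f x = (\<Sum>b\<in>A. Poly_Mapping.lookup x b *\<^sub>C f b)"
  unfolding lin_ext_def using assms
  by (intro sum.mono_neutral_left) (auto simp: in_keys_iff)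

lemma lin_ext_add: "lin_ext f (x + y) = lin_ext f x + lin_ext f y"
proof -
  let ?A = "Poly_Mapping.keys x \<union> Poly_Mapping.keys y"
  have "lin_ext f (x + y) = (\<Sum>b\<in>?A. Poly_Mapping.lookup (x + y) b *\<^sub>C f b)"
    by (rule lin_ext_superset) (auto simp: Poly_Mapping.keys_add)
  also have "\<dots> = (\<Sum>b\<in>?A. Poly_Mapping.lookup x b *\<^sub>C f b) + (\<Sum>b\<in>?A. Poly_Mapping.lookup y b *\<^sub>C f b)"
    by (simp add: lookup_add scaleC_add_left sum.distrib)
  also have "\<dots> = lin_ext f x + lin_ext f y"
    by (simp add: lin_ext_superset[of ?A])
  finally show ?thesis .
qed

lemma lin_ext_scale: "lin_ext f (c *\<^sub>C x) = c *\<^sub>C lin_ext f x"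
proof -
  let ?A = "Poly_Mapping.keys x"
  have "lin_ext f (c *\<^sub>C x) = (\<Sum>b\<in>?A. Poly_Mapping.lookup (c *\<^sub>C x) b *\<^sub>C f b)"
    by (rule lin_ext_superset) (auto simp: in_keys_iff lookup_scaleC)
  also have "\<dots> = c *\<^sub>C lin_ext f x"
    by (simp add: lookup_scaleC lin_ext_def scaleC_complex_def cvs.scale_sum_right)
  finally show ?thesis .
qed

lemma linearC_lin_ext: "linearC (lin_ext f)"
  by (simp add: linearC_def lin_ext_add lin_ext_scale)

lemma lin_ext_basis_vec [simp]: "lin_ext f (basis_vec b) = f b"
  by (simp add: lin_ext_def basis_vec_def)

lemma linearC_add: "linearC f \<Longrightarrow> f (v + w) = f v + f w"
  and linearC_scale: "linearC f \<Longrightarrow> f (c *\<^sub>C v) = c *\<^sub>C f v"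
  by (simp_all add: linearC_def)

lemma linearC_0: "linearC f \<Longrightarrow> f 0 = 0"
  using linearC_scale[of f 0 0] by simp

lemma linearC_minus: "linearC f \<Longrightarrow> f (- v) = - f v"
  using linearC_scale[of f "- 1" v] by simp

lemma linearC_diff: "linearC f \<Longrightarrow> f (v - w) = f v - f w"
  using linearC_add[of f v "- w"] by (simp add: linearC_minus)

lemma linearC_sum: "linearC f \<Longrightarrow> f (sum g A) = (\<Sum>a\<in>A. f (g a))"
  by (induction A rule: infinite_finite_induct) (simp_all add: linearC_0 linearC_add)

lemma free_decomp: "x = (\<Sum>b\<in>Poly_Mapping.keys x. Poly_Mapping.lookup x b *\<^sub>C basis_vec b)"
  (is "x = ?r")
proof (rule poly_mapping_eqI)
  fix k
  have "Poly_Mapping.lookup ?r k = (\<Sum>b\<in>Poly_Mapping.keys x. Poly_Mapping.lookup x b * (if b = k then 1 else 0))"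
    by (simp add: lookup_sum lookup_scaleC scaleC_complex_def basis_vec_def lookup_single when_def)
  also have "\<dots> = Poly_Mapping.lookup x k"
    by (simp add: in_keys_iff if_distrib sum.delta cong: if_cong)
  finally show "Poly_Mapping.lookup x k = Poly_Mapping.lookup ?r k" by simp
qed

lemma linearC_eq_lin_ext:
  assumes "linearC f"
  shows "f x = lin_ext (\<lambda>b. f (basis_vec b)) x"
  by (subst free_decomp[of x]) (simp add: linearC_sum linearC_scale assms lin_ext_def)

lemma linearC_cong_basis:
  assumes "linearC f" "linearC g" "\<And>b. f (basis_vec b) = g (basis_vec b)"
  shows "f x = g x"
  by (subst (1) linearC_eq_lin_ext[OF assms(1)], subst linearC_eq_lin_ext[OF assms(2)]) (simp add: assms(3))


lemma linearC_plus: "linearC f \<Longrightarrow> linearC g \<Longrightarrow> linearC (\<lambda>x. f x + g x)"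
  by (simp add: linearC_def scaleC_add_right)

lemma linearC_sum': "(\<And>k. k \<in> A \<Longrightarrow> linearC (f k)) \<Longrightarrow> linearC (\<lambda>x. \<Sum>k\<in>A. f k x)"
  by (simp add: linearC_def sum.distrib cvs.scale_sum_right)

lemma linearC_comp: "linearC f \<Longrightarrow> linearC g \<Longrightarrow> linearC (\<lambda>x. f (g x))"
  by (simp add: linearC_def)


section \<open>The planar Galilean conformal algebra\<close>

datatype gca_index = gL int | gH int | gI int | gJ int

type_synonym gca = "gca_index \<Rightarrow>\<^sub>0 complex"

fun gca_basis_bracket :: "gca_index \<Rightarrow> gca_index \<Rightarrow> gca" where
  "gca_basis_bracket (gL m) (gL n) = of_int (n - m) *\<^sub>C basis_vec (gL (m + n))"
| "gca_basis_bracket (gL m) (gH n) = of_int n *\<^sub>C basis_vec (gH (m + n))"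
| "gca_basis_bracket (gL m) (gI n) = of_int (n - m) *\<^sub>C basis_vec (gI (m + n))"
| "gca_basis_bracket (gL m) (gJ n) = of_int (n - m) *\<^sub>C basis_vec (gJ (m + n))"
| "gca_basis_bracket (gH m) (gI n) = basis_vec (gI (m + n))"
| "gca_basis_bracket (gH m) (gJ n) = - basis_vec (gJ (m + n))"
| "gca_basis_bracket (gH m) (gL n) = - (of_int m *\<^sub>C basis_vec (gH (n + m)))"
| "gca_basis_bracket (gI m) (gL n) = - (of_int (m - n) *\<^sub>C basis_vec (gI (n + m)))"
| "gca_basis_bracket (gJ m) (gL n) = - (of_int (m - n) *\<^sub>C basis_vec (gJ (n + m)))"
| "gca_basis_bracket (gI m) (gH n) = - basis_vec (gI (n + m))"
| "gca_basis_bracket (gJ m) (gH n) = basis_vec (gJ (n + m))"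
| "gca_basis_bracket _ _ = 0"

definition gca_bracket :: "gca \<Rightarrow> gca \<Rightarrow> gca" where
  "gca_bracket x y = lin_ext (\<lambda>a. lin_ext (gca_basis_bracket a) y) x"

lemma gca_bracket_basis: "gca_bracket (basis_vec a) (basis_vec b) = gca_basis_bracket a b"
  by (simp add: gca_bracket_def)

lemma gca_bracket_linear_left: "linearC (\<lambda>x. gca_bracket x y)"
  unfolding gca_bracket_def by (rule linearC_lin_ext)

lemma gca_bracket_linear_right: "linearC (\<lambda>y. gca_bracket x y)"
  unfolding gca_bracket_def linearC_def
  by (simp add: lin_ext_add lin_ext_scale)
     (simp add: lin_ext_def scaleC_add_right sum.distrib cvs.scale_sum_right ac_simps)

lemma gca_bracket_antisym: "gca_bracket x y = - gca_bracket y x"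
proof -
  have b: "gca_basis_bracket a b = - gca_basis_bracket b a" for a b
    by (cases a; cases b; simp add: algebra_simps)
  have n: "linearC (\<lambda>y. - f y)" if "linearC f" for f :: "gca \<Rightarrow> gca"
    using that by (simp add: linearC_def)
  have 1: "gca_bracket (basis_vec a) y = - gca_bracket y (basis_vec a)" for a y
    by (rule linearC_cong_basis[OF gca_bracket_linear_right n[OF gca_bracket_linear_left]])
       (unfold gca_bracket_basis, rule b)
  show ?thesis
    by (rule linearC_cong_basis[OF gca_bracket_linear_left n[OF gca_bracket_linear_right]]) (rule 1)
qed

lemma gca_jacobi_basis: "gca_bracket (basis_vec a) (gca_bracket (basis_vec b) (basis_vec c))
  + gca_bracket (basis_vec b) (gca_bracket (basis_vec c) (basis_vec a))
  + gca_bracket (basis_vec c) (gca_bracket (basis_vec a) (basis_vec b)) = 0"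
  by (cases a; cases b; cases c;
      simp add: gca_bracket_basis linearC_scale[OF gca_bracket_linear_right] linearC_minus[OF gca_bracket_linear_right]
        linearC_0[OF gca_bracket_linear_right] ac_simps;
      rule poly_mapping_eqI;
      simp add: lookup_add lookup_minus lookup_uminus lookup_scaleC basis_vec_def lookup_single when_def scaleC_complex_def;
      simp add: algebra_simps lookup_add lookup_minus lookup_uminus lookup_scaleC scaleC_complex_def lookup_single when_def)


lemma gca_jacobi:
  "gca_bracket x (gca_bracket y z) + gca_bracket y (gca_bracket z x)
     + gca_bracket z (gca_bracket x y) = 0" (is "?J x y z = 0")
proof -
  note simps = linearC_def linearC_add[OF gca_bracket_linear_left] linearC_add[OF gca_bracket_linear_right]
    linearC_scale[OF gca_bracket_linear_left] linearC_scale[OF gca_bracket_linear_right] scaleC_add_right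
  have L: "linearC (\<lambda>x. ?J x y z)" "linearC (\<lambda>y. ?J x y z)" "linearC (\<lambda>z. ?J x y z)" for x y z
    by (simp_all add: simps ac_simps)
  have 0: "linearC (\<lambda>_ :: gca. 0 :: gca)" by (simp add: linearC_def)
  have 1: "?J (basis_vec a) (basis_vec b) z = 0" for a b z
    by (rule linearC_cong_basis[OF L(3) 0]) (rule gca_jacobi_basis)
  have 2: "?J (basis_vec a) y z = 0" for a y z
    by (rule linearC_cong_basis[OF L(2) 0]) (rule 1)
  show ?thesis
    by (rule linearC_cong_basis[OF L(1) 0]) (rule 2)
qed

definition gca_component :: "int \<Rightarrow> gca set" where
  "gca_component n =
     cvs.span {basis_vec (gL n), basis_vec (gH n), basis_vec (gI n), basis_vec (gJ n)}"


section \<open>Modules\<close>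

text \<open>
  The carrier \<open>M\<close> of a module is a subspace of an ambient complex vector space type; a module
  living on a whole type has carrier \<open>UNIV\<close>.
\<close>

locale gca_module =
  fixes M :: "'v::complex_vector set" and act :: "gca \<Rightarrow> 'v \<Rightarrow> 'v"
  assumes subspace: "cvs.subspace M"
    and closed: "v \<in> M \<Longrightarrow> act x v \<in> M"
    and add_right: "v \<in> M \<Longrightarrow> w \<in> M \<Longrightarrow> act x (v + w) = act x v + act x w"
    and scale_right: "v \<in> M \<Longrightarrow> act x (c *\<^sub>C v) = c *\<^sub>C act x v"
    and add_left: "v \<in> M \<Longrightarrow> act (x + y) v = act x v + act y v"
    and scale_left: "v \<in> M \<Longrightarrow> act (c *\<^sub>C x) v = c *\<^sub>C act x v"
    and bracket: "v \<in> M \<Longrightarrow> act (gca_bracket x y) v = act x (act y v) - act y (act x v)"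

lemma gca_module_UNIV_linear:
  assumes "gca_module UNIV act"
  shows "linearC (act x)" "linearC (\<lambda>x. act x v)"
    "act (gca_bracket x y) v = act x (act y v) - act y (act x v)"
  using assms by (simp_all add: gca_module_def linearC_def)


lemma gca_module_lin_extI:
  fixes phi :: "gca_index \<Rightarrow> 'v::complex_vector \<Rightarrow> 'v"
  assumes lin: "\<And>b. linearC (phi b)"
    and br: "\<And>a b v. lin_ext (\<lambda>c. phi c v) (gca_basis_bracket a b) = phi a (phi b v) - phi b (phi a v)"
  shows "gca_module UNIV (\<lambda>x v. lin_ext (\<lambda>b. phi b v) x)"
proof -
  let ?act = "\<lambda>x v. lin_ext (\<lambda>b. phi b v) x"
  have r: "linearC (?act x)" for x
    by (auto simp: linearC_def lin_ext_def linearC_add[OF lin] linearC_scale[OF lin]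
        scaleC_add_right sum.distrib cvs.scale_sum_right mult.commute)
  have cc: "linearC (\<lambda>x. ?act (f x) v)" if "linearC f" for f :: "gca \<Rightarrow> gca" and v
    using that linearC_lin_ext[of "\<lambda>b. phi b v"] by (simp add: linearC_def)
  have d1: "linearC (\<lambda>x. ?act x (g v) - h (?act x v))" if "linearC h" for g h :: "'v \<Rightarrow> 'v" and v
    using that by (simp add: linearC_def lin_ext_add lin_ext_scale cvs.scale_right_diff_distrib)
  have d2: "linearC (\<lambda>x. h (?act x v) - ?act x (g v))" if "linearC h" for g h :: "'v \<Rightarrow> 'v" and v
    using that by (simp add: linearC_def lin_ext_add lin_ext_scale cvs.scale_right_diff_distrib)
  have b: "?act (gca_bracket x y) v = ?act x (?act y v) - ?act y (?act x v)" for x y v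
  proof (rule linearC_cong_basis[OF cc[OF gca_bracket_linear_left] d1[OF r]])
    fix a
    show "?act (gca_bracket (basis_vec a) y) v = ?act (basis_vec a) (?act y v) - ?act y (?act (basis_vec a) v)"
    proof (rule linearC_cong_basis[OF cc[OF gca_bracket_linear_right] d2[OF r]])
      fix b
      show "?act (gca_bracket (basis_vec a) (basis_vec b)) v
        = ?act (basis_vec a) (?act (basis_vec b) v) - ?act (basis_vec b) (?act (basis_vec a) v)"
        by (simp add: gca_bracket_basis br)
    qed
  qed
  show ?thesis
    using b by unfold_locales
      (simp_all add: lin_ext_add lin_ext_scale linearC_add[OF r] linearC_scale[OF r])
qed

definition gca_submodule ::
  "'v::complex_vector set \<Rightarrow> 'v set \<Rightarrow> (gca \<Rightarrow> 'v \<Rightarrow> 'v) \<Rightarrow> bool" where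
  "gca_submodule U M act \<longleftrightarrow> U \<subseteq> M \<and> cvs.subspace U \<and> (\<forall>x. \<forall>u\<in>U. act x u \<in> U)"

definition simple_gca_module :: "'v::complex_vector set \<Rightarrow> (gca \<Rightarrow> 'v \<Rightarrow> 'v) \<Rightarrow> bool" where
  "simple_gca_module M act \<longleftrightarrow>
     gca_module M act \<and> M \<noteq> {0} \<and> (\<forall>U. gca_submodule U M act \<longrightarrow> U = {0} \<or> U = M)"

definition restricted_gca_module :: "'v::complex_vector set \<Rightarrow> (gca \<Rightarrow> 'v \<Rightarrow> 'v) \<Rightarrow> bool" where
  "restricted_gca_module M act \<longleftrightarrow>
     gca_module M act \<and>
     (\<forall>v\<in>M. \<exists>i::nat. \<forall>n\<ge>int i. \<forall>x\<in>gca_component n. act x v = 0)"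


section \<open>The modules \<open>\<Omega>(\<lambda>,\<sigma>,\<eta>)\<close> and \<open>\<Gamma>(\<lambda>,\<sigma>,\<eta>)\<close>\<close>

text \<open>
  Polynomials in two variables are elements of \<open>complex poly poly\<close>: the coefficients are polynomials
  in the first variable (\<open>s\<close> or \<open>x\<close>), the outer variable is the second one (\<open>t\<close> or \<open>y\<close>).
  \<open>shift2 a b f\<close> is \<open>f(s + a, t + b)\<close>; see \<open>eval2_shift2\<close>.
\<close>

definition const2 :: "complex \<Rightarrow> complex poly poly" where "const2 c = [:[:c:]:]"
definition var1 :: "complex poly poly" where "var1 = [:[:0, 1:]:]"
definition var2 :: "complex poly poly" where "var2 = [:0, 1:]"

definition eval2 :: "complex poly poly \<Rightarrow> complex \<Rightarrow> complex \<Rightarrow> complex" where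
  "eval2 f a b = poly (poly f [:b:]) a"

definition shift2 :: "complex \<Rightarrow> complex \<Rightarrow> complex poly poly \<Rightarrow> complex poly poly" where
  "shift2 a b f = pcompose (map_poly (\<lambda>p. pcompose p [:a, 1:]) f) [:[:b:], 1:]"

lemma eval2_simps [simp]:
  "eval2 (const2 c) a b = c" "eval2 var1 a b = a" "eval2 var2 a b = b"
  "eval2 0 a b = 0" "eval2 (f + g) a b = eval2 f a b + eval2 g a b"
  "eval2 (f - g) a b = eval2 f a b - eval2 g a b" "eval2 (- f) a b = - eval2 f a b"
  "eval2 (f * g) a b = eval2 f a b * eval2 g a b"
  "eval2 (of_int n) a b = of_int n"
  by (simp_all add: eval2_def const2_def var1_def var2_def)

lemma scaleC_poly2: "c *\<^sub>C f = const2 c * f"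
  by (simp add: poly_eq_iff scaleC_poly.rep_eq scaleC_complex_def const2_def)

lemma eval2_scaleC [simp]: "eval2 (c *\<^sub>C f) a b = c * eval2 f a b"
  by (simp add: scaleC_poly2)

lemma eval2_shift2 [simp]: "eval2 (shift2 u w f) a b = eval2 f (a + u) (b + w)"
proof -
  have "eval2 (shift2 u w f) a b = poly (poly (map_poly (\<lambda>p. pcompose p [:u, 1:]) f) [:w + b:]) a"
    by (simp add: eval2_def shift2_def poly_pcompose)
  also have "\<dots> = poly (poly f [:b + w:]) (a + u)"
    by (induction f) (simp_all add: map_poly_pCons poly_pcompose add.commute)
  finally show ?thesis by (simp add: eval2_def)
qed

lemma eval2_eqI:
  assumes "\<And>a b. eval2 f a b = eval2 g a b"
  shows "f = g"
proof -
  have "poly f [:b:] = poly g [:b:]" for b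
    using assms by (simp add: eval2_def fun_eq_iff flip: poly_eq_poly_eq_iff)
  then have z: "poly (f - g) [:b:] = 0" for b by simp
  show ?thesis
  proof (rule ccontr)
    assume "f \<noteq> g"
    then have "finite {p. poly (f - g) p = 0}" by (intro poly_roots_finite) simp
    moreover have "range (\<lambda>b. [:b:]) \<subseteq> {p. poly (f - g) p = 0}" using z by auto
    ultimately have "finite (range (\<lambda>b::complex. [:b:]))" by (rule rev_finite_subset)
    then have "finite (UNIV :: complex set)" by (rule finite_imageD) (simp add: inj_def)
    then show False by (simp add: infinite_UNIV_char_0)
  qed
qed

fun Omega_basis ::
  "complex \<Rightarrow> complex \<Rightarrow> complex \<Rightarrow> gca_index \<Rightarrow> complex poly poly \<Rightarrow> complex poly poly" where
  "Omega_basis lam sig eta (gL n) f =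
     (lam powi n) *\<^sub>C ((var1 - of_int n * var2 + of_int n * const2 eta) * shift2 (- of_int n) 0 f)"
| "Omega_basis lam sig eta (gH n) f = (lam powi n) *\<^sub>C (var2 * shift2 (- of_int n) 0 f)"
| "Omega_basis lam sig eta (gI n) f = (lam powi n * sig) *\<^sub>C shift2 (- of_int n) (- 1) f"
| "Omega_basis lam sig eta (gJ n) f = 0"

fun Gamma_basis ::
  "complex \<Rightarrow> complex \<Rightarrow> complex \<Rightarrow> gca_index \<Rightarrow> complex poly poly \<Rightarrow> complex poly poly" where
  "Gamma_basis lam sig eta (gL n) g =
     (lam powi n) *\<^sub>C ((var1 + of_int n * var2 + of_int n * const2 eta) * shift2 (- of_int n) 0 g)"
| "Gamma_basis lam sig eta (gH n) g = (lam powi n) *\<^sub>C (var2 * shift2 (- of_int n) 0 g)"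
| "Gamma_basis lam sig eta (gI n) g = 0"
| "Gamma_basis lam sig eta (gJ n) g = (lam powi n * sig) *\<^sub>C shift2 (- of_int n) 1 g"

definition Omega_act ::
  "complex \<Rightarrow> complex \<Rightarrow> complex \<Rightarrow> gca \<Rightarrow> complex poly poly \<Rightarrow> complex poly poly" where
  "Omega_act lam sig eta x f = lin_ext (\<lambda>b. Omega_basis lam sig eta b f) x"

definition Gamma_act ::
  "complex \<Rightarrow> complex \<Rightarrow> complex \<Rightarrow> gca \<Rightarrow> complex poly poly \<Rightarrow> complex poly poly" where
  "Gamma_act lam sig eta x g = lin_ext (\<lambda>b. Gamma_basis lam sig eta b g) x"

lemma linearC_Omega_basis: "linearC (Omega_basis lam sig eta b)"
  by (cases b) (auto simp: linearC_def algebra_simps intro!: eval2_eqI)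

lemma linearC_Gamma_basis: "linearC (Gamma_basis lam sig eta b)"
  by (cases b) (auto simp: linearC_def algebra_simps intro!: eval2_eqI)

lemma Omega_module: assumes "lam \<noteq> 0" shows "gca_module UNIV (Omega_act lam sig eta)"
  unfolding Omega_act_def[abs_def]
proof (rule gca_module_lin_extI[OF linearC_Omega_basis])
  fix a b v
  show "lin_ext (\<lambda>c. Omega_basis lam sig eta c v) (gca_basis_bracket a b) =
       Omega_basis lam sig eta a (Omega_basis lam sig eta b v) - Omega_basis lam sig eta b (Omega_basis lam sig eta a v)"
    by (rule eval2_eqI, cases a; cases b;
      simp add: lin_ext_scale linearC_minus[OF linearC_lin_ext] linearC_0[OF linearC_lin_ext]
        power_int_add assms; simp add: algebra_simps)
qed

lemma Gamma_module: assumes "lam \<noteq> 0" shows "gca_module UNIV (Gamma_act lam sig eta)"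
  unfolding Gamma_act_def[abs_def]
proof (rule gca_module_lin_extI[OF linearC_Gamma_basis])
  fix a b v
  show "lin_ext (\<lambda>c. Gamma_basis lam sig eta c v) (gca_basis_bracket a b) =
       Gamma_basis lam sig eta a (Gamma_basis lam sig eta b v) - Gamma_basis lam sig eta b (Gamma_basis lam sig eta a v)"
    by (rule eval2_eqI, cases a; cases b;
      simp add: lin_ext_scale linearC_minus[OF linearC_lin_ext] linearC_0[OF linearC_lin_ext]
        power_int_add assms; simp add: algebra_simps)
qed


section \<open>Tensor products\<close>

text \<open>
  For complex vector spaces \<open>P = 'a\<close> and \<open>V = 'v\<close>, the type \<open>('a, 'v) tensor\<close> is the free vector
  space on all pairs \<open>([p\<^sub>1, \<dots>, p\<^sub>r], v)\<close>, of any length \<open>r\<close>, modulo the relations of multilinearity.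
  The relations preserve the length, so the type is the direct sum over \<open>r\<close> of the spaces
  \<open>P \<otimes> \<dots> \<otimes> P \<otimes> V\<close> with \<open>r\<close> factors \<open>P\<close>; the \<open>r\<close>-th summand is \<open>tensor_space r\<close>.
\<close>

inductive_set tensor_relators ::
  "(('a::complex_vector list \<times> 'v::complex_vector) \<Rightarrow>\<^sub>0 complex) set" where
  factor_add: "i < length ps \<Longrightarrow>
     basis_vec (ps[i := p + q], v) - basis_vec (ps[i := p], v) - basis_vec (ps[i := q], v)
       \<in> tensor_relators"
| factor_scale: "i < length ps \<Longrightarrow>
     basis_vec (ps[i := c *\<^sub>C p], v) - c *\<^sub>C basis_vec (ps[i := p], v) \<in> tensor_relators"
| last_add:
    "basis_vec (ps, v + w) - basis_vec (ps, v) - basis_vec (ps, w) \<in> tensor_relators"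
| last_scale:
    "basis_vec (ps, c *\<^sub>C v) - c *\<^sub>C basis_vec (ps, v) \<in> tensor_relators"

definition tensor_eq ::
  "(('a::complex_vector list \<times> 'v::complex_vector) \<Rightarrow>\<^sub>0 complex) \<Rightarrow>
   (('a list \<times> 'v) \<Rightarrow>\<^sub>0 complex) \<Rightarrow> bool" where
  "tensor_eq F G \<longleftrightarrow> F - G \<in> cvs.span tensor_relators"

lemma equivp_tensor_eq:
  "equivp (tensor_eq ::
     (('a::complex_vector list \<times> 'v::complex_vector) \<Rightarrow>\<^sub>0 complex) \<Rightarrow> _)"
proof (rule equivpI)
  show "reflp (tensor_eq :: (('a list \<times> 'v) \<Rightarrow>\<^sub>0 complex) \<Rightarrow> _)"
    by (rule reflpI) (simp add: tensor_eq_def cvs.span_zero)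
  show "symp (tensor_eq :: (('a list \<times> 'v) \<Rightarrow>\<^sub>0 complex) \<Rightarrow> _)"
  proof (rule sympI)
    fix F G :: "('a list \<times> 'v) \<Rightarrow>\<^sub>0 complex"
    assume "tensor_eq F G"
    then have "- (F - G) \<in> cvs.span tensor_relators"
      unfolding tensor_eq_def by (rule cvs.span_neg)
    then show "tensor_eq G F" by (simp add: tensor_eq_def)
  qed
  show "transp (tensor_eq :: (('a list \<times> 'v) \<Rightarrow>\<^sub>0 complex) \<Rightarrow> _)"
  proof (rule transpI)
    fix F G H :: "('a list \<times> 'v) \<Rightarrow>\<^sub>0 complex"
    assume "tensor_eq F G" "tensor_eq G H"
    then have "(F - G) + (G - H) \<in> cvs.span tensor_relators"
      unfolding tensor_eq_def by (rule cvs.span_add)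
    then show "tensor_eq F H" by (simp add: tensor_eq_def)
  qed
qed

quotient_type (overloaded) ('a, 'v) tensor =
  "('a::complex_vector list \<times> 'v::complex_vector) \<Rightarrow>\<^sub>0 complex" / tensor_eq
  by (rule equivp_tensor_eq)

instantiation tensor :: (complex_vector, complex_vector) complex_vector
begin

lift_definition zero_tensor :: "('a, 'b) tensor" is 0 .

lift_definition plus_tensor :: "('a, 'b) tensor \<Rightarrow> ('a, 'b) tensor \<Rightarrow> ('a, 'b) tensor" is "(+)"
proof -
  fix F F' G G' :: "('a list \<times> 'b) \<Rightarrow>\<^sub>0 complex"
  assume "tensor_eq F F'" "tensor_eq G G'"
  then have "(F - F') + (G - G') \<in> cvs.span tensor_relators"
    unfolding tensor_eq_def by (rule cvs.span_add)
  then show "tensor_eq (F + G) (F' + G')" by (simp add: tensor_eq_def algebra_simps)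
qed

lift_definition uminus_tensor :: "('a, 'b) tensor \<Rightarrow> ('a, 'b) tensor" is uminus
proof -
  fix F F' :: "('a list \<times> 'b) \<Rightarrow>\<^sub>0 complex"
  assume "tensor_eq F F'"
  then have "- (F - F') \<in> cvs.span tensor_relators"
    unfolding tensor_eq_def by (rule cvs.span_neg)
  then show "tensor_eq (- F) (- F')" by (simp add: tensor_eq_def algebra_simps)
qed

lift_definition minus_tensor :: "('a, 'b) tensor \<Rightarrow> ('a, 'b) tensor \<Rightarrow> ('a, 'b) tensor" is "(-)"
proof -
  fix F F' G G' :: "('a list \<times> 'b) \<Rightarrow>\<^sub>0 complex"
  assume "tensor_eq F F'" "tensor_eq G G'"
  then have "(F - F') - (G - G') \<in> cvs.span tensor_relators"
    unfolding tensor_eq_def by (rule cvs.span_diff)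
  then show "tensor_eq (F - G) (F' - G')" by (simp add: tensor_eq_def algebra_simps)
qed

lift_definition scaleC_tensor :: "complex \<Rightarrow> ('a, 'b) tensor \<Rightarrow> ('a, 'b) tensor" is scaleC
proof -
  fix c and F F' :: "('a list \<times> 'b) \<Rightarrow>\<^sub>0 complex"
  assume "tensor_eq F F'"
  then have "c *\<^sub>C (F - F') \<in> cvs.span tensor_relators"
    unfolding tensor_eq_def by (rule cvs.span_scale)
  then show "tensor_eq (c *\<^sub>C F) (c *\<^sub>C F')"
    by (simp add: tensor_eq_def cvs.scale_right_diff_distrib)
qed

instance
proof
  fix X Y Z :: "('a, 'b) tensor" and a b :: complex
  show "X + Y + Z = X + (Y + Z)" by transfer (simp add: tensor_eq_def cvs.span_zero add.assoc)
  show "X + Y = Y + X" by transfer (simp add: tensor_eq_def cvs.span_zero add.commute)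
  show "0 + X = X" by transfer (simp add: tensor_eq_def cvs.span_zero)
  show "- X + X = 0" by transfer (simp add: tensor_eq_def cvs.span_zero)
  show "X - Y = X + - Y" by transfer (simp add: tensor_eq_def cvs.span_zero)
  show "a *\<^sub>C (X + Y) = a *\<^sub>C X + a *\<^sub>C Y"
    by transfer (simp add: tensor_eq_def cvs.span_zero scaleC_add_right)
  show "(a + b) *\<^sub>C X = a *\<^sub>C X + b *\<^sub>C X"
    by transfer (simp add: tensor_eq_def cvs.span_zero scaleC_add_left)
  show "a *\<^sub>C b *\<^sub>C X = (a * b) *\<^sub>C X"
    by transfer (simp add: tensor_eq_def cvs.span_zero)
  show "1 *\<^sub>C X = X"
    by transfer (simp add: tensor_eq_def cvs.span_zero)
qed

end

definition pure_tensor ::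
  "'a::complex_vector list \<Rightarrow> 'v::complex_vector \<Rightarrow> ('a, 'v) tensor" where
  "pure_tensor ps v = abs_tensor (basis_vec (ps, v))"

definition tensor_space :: "nat \<Rightarrow> ('a::complex_vector, 'v::complex_vector) tensor set" where
  "tensor_space r = cvs.span {pure_tensor ps v |ps v. length ps = r}"

definition multilinearC :: "('a::complex_vector list \<times> 'v::complex_vector \<Rightarrow> 'w::complex_vector) \<Rightarrow> bool" where
  "multilinearC f \<longleftrightarrow>
     (\<forall>ps v i. i < length ps \<longrightarrow> linearC (\<lambda>p. f (ps[i := p], v))) \<and> (\<forall>ps. linearC (\<lambda>v. f (ps, v)))"

text \<open>
  Universal property: \<open>multilinear_pure\<close>, \<open>tensor_lift\<close> (existence of the linear extension of a
  multilinear map) and \<open>tensor_space_ext\<close> (uniqueness).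
\<close>

lemma tensor_lift:
  fixes f :: "'a::complex_vector list \<times> 'b::complex_vector \<Rightarrow> 'w::complex_vector"
  assumes "multilinearC f"
  shows "linearC (\<lambda>X. lin_ext f (rep_tensor X))"
    and "lin_ext f (rep_tensor (pure_tensor ps v)) = f (ps, v)"
proof -
  note L = linearC_lin_ext[of f]
  have rel: "lin_ext f F = 0" if "F \<in> tensor_relators" for F
    using that
  proof cases
    case (factor_add i ps p q v)
    with assms have "linearC (\<lambda>p. f (ps[i := p], v))" by (simp add: multilinearC_def)
    from linearC_add[OF this, of p q] show ?thesis
      by (simp add: factor_add linearC_diff[OF L])
  next
    case (factor_scale i ps c p v)
    with assms have "linearC (\<lambda>p. f (ps[i := p], v))" by (simp add: multilinearC_def)
    from linearC_scale[OF this, of c p] show ?thesis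
      by (simp add: factor_scale linearC_diff[OF L] linearC_scale[OF L])
  next
    case (last_add ps v w)
    from assms have "linearC (\<lambda>v. f (ps, v))" by (simp add: multilinearC_def)
    from linearC_add[OF this, of v w] show ?thesis
      by (simp add: last_add linearC_diff[OF L])
  next
    case (last_scale ps c v)
    from assms have "linearC (\<lambda>v. f (ps, v))" by (simp add: multilinearC_def)
    from linearC_scale[OF this, of c v] show ?thesis
      by (simp add: last_scale linearC_diff[OF L] linearC_scale[OF L])
  qed
  have sp: "lin_ext f F = 0" if "F \<in> cvs.span tensor_relators" for F
    using that
    by (induction rule: cvs.span_induct_alt)
       (simp_all add: linearC_0[OF L] linearC_add[OF L] linearC_scale[OF L] rel)
  have abs: "lin_ext f (rep_tensor (abs_tensor F)) = lin_ext f F" for F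
  proof -
    have "tensor_eq (rep_tensor (abs_tensor F)) F"
      by (rule Quotient3_rep_abs[OF Quotient3_tensor]) (simp add: equivp_reflp[OF equivp_tensor_eq])
    then have "lin_ext f (rep_tensor (abs_tensor F) - F) = 0"
      unfolding tensor_eq_def by (rule sp)
    then show ?thesis by (simp add: linearC_diff[OF L])
  qed
  show "lin_ext f (rep_tensor (pure_tensor ps v)) = f (ps, v)"
    by (simp add: pure_tensor_def abs)
  have ex: "\<exists>F. X = abs_tensor F" for X :: "('a, 'b) tensor"
    by (metis Quotient3_abs_rep[OF Quotient3_tensor])
  show "linearC (\<lambda>X. lin_ext f (rep_tensor X))"
    unfolding linearC_def
  proof (intro conjI allI)
    fix X Y :: "('a, 'b) tensor" and c
    obtain F G where FG: "X = abs_tensor F" "Y = abs_tensor G" using ex by blast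
    show "lin_ext f (rep_tensor (X + Y)) = lin_ext f (rep_tensor X) + lin_ext f (rep_tensor Y)"
      by (simp add: FG plus_tensor.abs_eq abs lin_ext_add)
    show "lin_ext f (rep_tensor (c *\<^sub>C X)) = c *\<^sub>C lin_ext f (rep_tensor X)"
      by (simp add: FG scaleC_tensor.abs_eq abs lin_ext_scale)
  qed
qed

lemma abs_tensor_eq_iff: "abs_tensor F = abs_tensor G \<longleftrightarrow> F - G \<in> cvs.span tensor_relators"
  using Quotient3_rel_abs[OF Quotient3_tensor] Quotient3_rel[OF Quotient3_tensor, of F G]
  by (simp add: tensor_eq_def cvs.span_zero)

lemma abs_tensor_0: assumes "F \<in> tensor_relators" shows "abs_tensor F = 0"
proof -
  have "abs_tensor F = abs_tensor 0" using assms by (simp add: abs_tensor_eq_iff cvs.span_base)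
  then show ?thesis by (simp add: zero_tensor_def)
qed

lemma multilinear_pure:
  fixes ps :: "'a::complex_vector list" and v :: "'v::complex_vector"
  shows "i < length ps \<Longrightarrow> linearC (\<lambda>p. pure_tensor (ps[i := p]) v)"
    "linearC (pure_tensor ps :: 'v \<Rightarrow> _)"
proof -
  show "linearC (\<lambda>p. pure_tensor (ps[i := p]) v)" if "i < length ps"
    using abs_tensor_0[OF factor_add[OF that, where v = v]] abs_tensor_0[OF factor_scale[OF that, where v = v]]
    by (simp add: linearC_def pure_tensor_def diff_eq_eq add.commute
        flip: minus_tensor.abs_eq scaleC_tensor.abs_eq)
  have "pure_tensor ps (u + w) = pure_tensor ps u + pure_tensor ps w"
    "pure_tensor ps (c *\<^sub>C u) = c *\<^sub>C pure_tensor ps u" for u w :: 'v and c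
    using abs_tensor_0[OF last_add[of ps u w]] abs_tensor_0[OF last_scale[of ps c u]]
    by (simp_all add: pure_tensor_def diff_eq_eq add.commute
        flip: minus_tensor.abs_eq scaleC_tensor.abs_eq)
  then show "linearC (pure_tensor ps :: 'v \<Rightarrow> _)"
    by (simp add: linearC_def)
qed


lemma tensor_space_ext:
  assumes "linearC f" "linearC g" "\<And>ps v. length ps = r \<Longrightarrow> f (pure_tensor ps v) = g (pure_tensor ps v)"
    and "X \<in> tensor_space r"
  shows "f X = g X"
  using assms(4) unfolding tensor_space_def
  by (induction rule: cvs.span_induct_alt)
     (auto simp: linearC_0 linearC_add linearC_scale assms)

text \<open>
  The action on a tensor product, \<open>rho k\<close> being the action on the \<open>k\<close>-th factor \<open>P\<close> (counted from \<open>0\<close>).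
  The value does not depend on the chosen representative; see \<open>tensor_act_pure\<close>.
\<close>

definition tensor_act ::
  "(nat \<Rightarrow> gca \<Rightarrow> 'a::complex_vector \<Rightarrow> 'a) \<Rightarrow> (gca \<Rightarrow> 'v::complex_vector \<Rightarrow> 'v) \<Rightarrow>
   gca \<Rightarrow> ('a, 'v) tensor \<Rightarrow> ('a, 'v) tensor" where
  "tensor_act rho act x X =
     lin_ext
       (\<lambda>(ps, v). (\<Sum>k<length ps. pure_tensor (ps[k := rho k x (ps ! k)]) v)
                    + pure_tensor ps (act x v))
       (rep_tensor X)"

lemma multilinear_leibniz:
  assumes rho: "\<And>k. linearC (rho k)" and act: "linearC act"
  shows "multilinearC (\<lambda>(ps, v). (\<Sum>k<length ps. pure_tensor (ps[k := rho k (ps ! k)]) v) + pure_tensor ps (act v))"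
  unfolding multilinearC_def
proof (intro conjI allI impI)
  fix ps :: "'a list" and v :: 'b and i assume i: "i < length ps"
  have *: "linearC (\<lambda>p. pure_tensor (ps[i := p, k := rho k (ps[i := p] ! k)]) v)" if "k < length ps" for k
  proof (cases "k = i")
    case True
    then show ?thesis using i linearC_comp[OF multilinear_pure(1)[OF i] rho] by simp
  next
    case False
    then have "(\<lambda>p. pure_tensor (ps[i := p, k := rho k (ps[i := p] ! k)]) v) =
      (\<lambda>p. pure_tensor ((ps[k := rho k (ps ! k)])[i := p]) v)"
      by (simp add: list_update_swap)
    then show ?thesis using i by (simp add: multilinear_pure(1))
  qed
  show "linearC (\<lambda>p. case (ps[i := p], v) of (ps, v) \<Rightarrow>
      (\<Sum>k<length ps. pure_tensor (ps[k := rho k (ps ! k)]) v) + pure_tensor ps (act v))"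
    using i * by (simp, intro linearC_plus linearC_sum') (simp_all add: multilinear_pure(1))
next
  fix ps :: "'a list"
  show "linearC (\<lambda>v. case (ps, v) of (ps, v) \<Rightarrow>
      (\<Sum>k<length ps. pure_tensor (ps[k := rho k (ps ! k)]) v) + pure_tensor ps (act v))"
    by (simp, intro linearC_plus linearC_sum' multilinear_pure(2) linearC_comp[OF multilinear_pure(2) act])
qed

lemma
  assumes rho: "\<And>k. linearC (rho k x)" and act: "linearC (act x)"
  shows tensor_act_pure: "tensor_act rho act x (pure_tensor ps v) =
     (\<Sum>k<length ps. pure_tensor (ps[k := rho k x (ps ! k)]) v) + pure_tensor ps (act x v)"
  and linearC_tensor_act: "linearC (tensor_act rho act x)"
  using tensor_lift[OF multilinear_leibniz[where rho = "\<lambda>k. rho k x", OF rho act]]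
  by (simp_all add: tensor_act_def[abs_def])

lemma tensor_module:
  fixes rho :: "nat \<Rightarrow> gca \<Rightarrow> 'a::complex_vector \<Rightarrow> 'a" and act :: "gca \<Rightarrow> 'b::complex_vector \<Rightarrow> 'b"
  assumes lin: "\<And>k x. linearC (rho k x)" "\<And>k p. linearC (\<lambda>x. rho k x p)"
    and br: "\<And>k x y p. k < r \<Longrightarrow> rho k (gca_bracket x y) p = rho k x (rho k y p) - rho k y (rho k x p)"
    and act: "gca_module UNIV act"
  shows "gca_module (tensor_space r) (tensor_act rho act)"
proof -
  note actl = gca_module_UNIV_linear[OF act]
  note P = tensor_act_pure[of rho _ act, OF lin(1) actl(1)]
  note L = linearC_tensor_act[of rho _ act, OF lin(1) actl(1)]
  have pure_in: "pure_tensor ps v \<in> tensor_space r" if "length ps = r"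
    for ps :: "'a list" and v :: 'b
    unfolding tensor_space_def using that by (intro cvs.span_base) blast
  have sub: "cvs.subspace (tensor_space r)" unfolding tensor_space_def by (rule cvs.subspace_span)
  have closed: "tensor_act rho act x X \<in> tensor_space r" if "X \<in> tensor_space r" for x X
    using that unfolding tensor_space_def
  proof (induction rule: cvs.span_induct_alt)
    case base
    then show ?case by (simp add: linearC_0[OF L] cvs.span_zero)
  next
    case (step c X Y)
    then obtain ps v where X: "X = pure_tensor ps v" "length ps = r" by blast
    have "tensor_act rho act x X \<in> tensor_space r"
      unfolding X P by (intro cvs.subspace_add[OF sub] cvs.subspace_sum[OF sub] pure_in) (auto simp: X)
    then show ?case using step
      by (simp add: linearC_add[OF L] linearC_scale[OF L] tensor_space_def cvs.span_add cvs.span_scale)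
  qed
  have add: "tensor_act rho act (x + y) X = tensor_act rho act x X + tensor_act rho act y X"
    if "X \<in> tensor_space r" for x y X
    by (rule tensor_space_ext[OF L linearC_plus[OF L L] _ that])
       (simp add: P linearC_add[OF lin(2)] linearC_add[OF actl(2)] linearC_add[OF multilinear_pure(1)]
          linearC_add[OF multilinear_pure(2)] sum.distrib)
  have sc: "tensor_act rho act (c *\<^sub>C x) X = c *\<^sub>C tensor_act rho act x X"
    if "X \<in> tensor_space r" for x c X
  proof (rule tensor_space_ext[OF L _ _ that])
    show "linearC (\<lambda>X. c *\<^sub>C tensor_act rho act x X)"
      using L by (simp add: linearC_def scaleC_add_right mult.commute)
    show "tensor_act rho act (c *\<^sub>C x) (pure_tensor ps v) = c *\<^sub>C tensor_act rho act x (pure_tensor ps v)" for ps v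
      by (simp add: P linearC_scale[OF lin(2)] linearC_scale[OF actl(2)] linearC_scale[OF multilinear_pure(1)]
          linearC_scale[OF multilinear_pure(2)] scaleC_add_right cvs.scale_sum_right)
  qed
  have diff: "linearC (\<lambda>X. f X - g X)" if "linearC f" "linearC g"
    for f g :: "('a, 'b) tensor \<Rightarrow> ('a, 'b) tensor"
    using that by (simp add: linearC_def cvs.scale_right_diff_distrib)
  have brk: "tensor_act rho act (gca_bracket x y) X
      = tensor_act rho act x (tensor_act rho act y X) - tensor_act rho act y (tensor_act rho act x X)"
    if "X \<in> tensor_space r" for x y X
  proof (rule tensor_space_ext[OF L diff[OF linearC_comp[OF L L] linearC_comp[OF L L]] _ that])
    fix ps :: "'a list" and v :: 'b assume len: "length ps = r"
    define A where "A x y k j = pure_tensor (ps[k := rho k y (ps ! k), j := rho j x (ps[k := rho k y (ps ! k)] ! j)]) v"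
      for x y k j
    have A1: "A x y k j = A y x j k" if "k \<noteq> j" for x y k j
      using that by (simp add: A_def list_update_swap)
    have A2: "A x y k k - A y x k k = pure_tensor (ps[k := rho k (gca_bracket x y) (ps ! k)]) v" if "k < r" for x y k
      using that by (simp add: A_def len br linearC_diff[OF multilinear_pure(1)])
    have DD: "tensor_act rho act x (tensor_act rho act y (pure_tensor ps v)) =
       (\<Sum>k<r. \<Sum>j<r. A x y k j) + (\<Sum>k<r. pure_tensor (ps[k := rho k y (ps ! k)]) (act x v))
        + (\<Sum>k<r. pure_tensor (ps[k := rho k x (ps ! k)]) (act y v)) + pure_tensor ps (act x (act y v))" for x y
      by (simp add: P linearC_add[OF L] linearC_sum[OF L] len A_def sum.distrib)
    have "(\<Sum>k<r. \<Sum>j<r. A x y k j) - (\<Sum>k<r. \<Sum>j<r. A y x k j)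
       = (\<Sum>k<r. \<Sum>j<r. A x y k j) - (\<Sum>k<r. \<Sum>j<r. A y x j k)"
      by (subst sum.swap[of "\<lambda>k j. A y x k j"]) simp
    also have "\<dots> = (\<Sum>k<r. \<Sum>j<r. A x y k j - A y x j k)"
      by (simp add: sum_subtractf)
    also have "\<dots> = (\<Sum>k<r. \<Sum>j<r. if j = k then A x y k k - A y x k k else 0)"
      by (intro sum.cong refl) (use A1 in auto)
    also have "\<dots> = (\<Sum>k<r. pure_tensor (ps[k := rho k (gca_bracket x y) (ps ! k)]) v)"
      by (simp add: A2)
    finally have S: "(\<Sum>k<r. \<Sum>j<r. A x y k j) - (\<Sum>k<r. \<Sum>j<r. A y x k j) = \<dots>" .
    have "tensor_act rho act x (tensor_act rho act y (pure_tensor ps v))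
          - tensor_act rho act y (tensor_act rho act x (pure_tensor ps v))
       = ((\<Sum>k<r. \<Sum>j<r. A x y k j) - (\<Sum>k<r. \<Sum>j<r. A y x k j))
          + (pure_tensor ps (act x (act y v)) - pure_tensor ps (act y (act x v)))"
      unfolding DD by simp
    also have "\<dots> = tensor_act rho act (gca_bracket x y) (pure_tensor ps v)"
      unfolding S by (simp add: P len actl(3) linearC_diff[OF multilinear_pure(2)])
    finally show "tensor_act rho act (gca_bracket x y) (pure_tensor ps v) =
      tensor_act rho act x (tensor_act rho act y (pure_tensor ps v))
          - tensor_act rho act y (tensor_act rho act x (pure_tensor ps v))" by simp
  qed
  show ?thesis
    using sub closed add sc brk by unfold_locales (simp_all add: linearC_add[OF L] linearC_scale[OF L])
qed

text \<open>
  The first \<open>m\<^sub>1\<close> factors are modules \<open>\<Omega>\<close>, the remaining ones are modules \<open>\<Gamma>\<close>.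
\<close>

definition T_act ::
  "nat \<Rightarrow> complex list \<Rightarrow> complex list \<Rightarrow> complex list \<Rightarrow> (gca \<Rightarrow> 'v::complex_vector \<Rightarrow> 'v) \<Rightarrow>
   gca \<Rightarrow> (complex poly poly, 'v) tensor \<Rightarrow> (complex poly poly, 'v) tensor" where
  "T_act m1 lams sigs etas act =
     tensor_act
       (\<lambda>k. if k < m1 then Omega_act (lams ! k) (sigs ! k) (etas ! k)
             else Gamma_act (lams ! k) (sigs ! k) (etas ! k))
       act"

lemma T_module:
  assumes "length lams = m1 + m2" "0 \<notin> set lams" "gca_module UNIV act"
  shows "gca_module (tensor_space (m1 + m2)) (T_act m1 lams sigs etas act)"
  unfolding T_act_def
proof (rule tensor_module[OF _ _ _ assms(3)])
  have O: "linearC (Omega_act a b c x)" "linearC (Gamma_act a b c x)" for a b c x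
    using linearC_Omega_basis linearC_Gamma_basis
    by (auto simp: Omega_act_def[abs_def] Gamma_act_def[abs_def] linearC_def lin_ext_def
        scaleC_add_right sum.distrib cvs.scale_sum_right mult.commute)
  have O': "linearC (\<lambda>x. Omega_act a b c x p)" "linearC (\<lambda>x. Gamma_act a b c x p)" for a b c p
    by (simp_all add: Omega_act_def Gamma_act_def linearC_lin_ext)
  fix k x y p
  show "linearC ((if k < m1 then Omega_act (lams ! k) (sigs ! k) (etas ! k)
        else Gamma_act (lams ! k) (sigs ! k) (etas ! k)) x)"
    by (simp add: O)
  show "linearC (\<lambda>x. (if k < m1 then Omega_act (lams ! k) (sigs ! k) (etas ! k)
        else Gamma_act (lams ! k) (sigs ! k) (etas ! k)) x p)"
    by (simp add: O')
  assume "k < m1 + m2"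
  then have "lams ! k \<noteq> 0" using assms by (metis nth_mem)
  then show "(if k < m1 then Omega_act (lams ! k) (sigs ! k) (etas ! k)
        else Gamma_act (lams ! k) (sigs ! k) (etas ! k)) (gca_bracket x y) p =
     (if k < m1 then Omega_act (lams ! k) (sigs ! k) (etas ! k)
        else Gamma_act (lams ! k) (sigs ! k) (etas ! k)) x
      ((if k < m1 then Omega_act (lams ! k) (sigs ! k) (etas ! k)
        else Gamma_act (lams ! k) (sigs ! k) (etas ! k)) y p) -
     (if k < m1 then Omega_act (lams ! k) (sigs ! k) (etas ! k)
        else Gamma_act (lams ! k) (sigs ! k) (etas ! k)) y
      ((if k < m1 then Omega_act (lams ! k) (sigs ! k) (etas ! k)
        else Gamma_act (lams ! k) (sigs ! k) (etas ! k)) x p)"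
    using gca_module_UNIV_linear(3)[OF Omega_module] gca_module_UNIV_linear(3)[OF Gamma_module]
    by simp
qed

end

theory Submission
  imports Defs
begin

text \<open>
  Why the theorem holds. Let \<open>\<rho>\<^sub>k\<close> be the action on the \<open>k\<close>-th polynomial factor. For each of the
  families \<open>g \<in> {L, H, I, J}\<close> the operator \<open>\<rho>\<^sub>k(g\<^sub>n)\<close> equals \<open>\<lambda>\<^sub>k\<^sup>n\<close> times an operator depending
  polynomially on \<open>n\<close>, in the sense that a high enough iterated difference in \<open>n\<close> annihilates its
  value at any given vector.

  Suppose the \<open>\<lambda>\<^sub>k\<close> are distinct and let \<open>U\<close> be a non-zero submodule. Since \<open>V\<close> is restricted,
  \<open>g\<^sub>n\<close> acts on a given vector of \<open>U\<close> only through the polynomial factors once \<open>n\<close> is large, and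
  sequences of the form \<open>polynomial \<cdot> \<lambda>\<^sub>k\<^sup>n\<close> for different \<open>\<lambda>\<^sub>k\<close> can be separated within a
  subspace (\<open>exponential_separation\<close>). Hence \<open>U\<close> is stable under the action of the algebra on every
  single tensor factor, also on \<open>V\<close>. On a polynomial factor this gives multiplication by both
  variables and two shifts. The differences \<open>shift - 1\<close> are locally nilpotent and commute, and the
  polynomials killed by both of them are the constants; so they lower a non-zero vector of \<open>U\<close> to a
  non-zero vector \<open>1 \<otimes> \<dots> \<otimes> 1 \<otimes> v\<close>. As \<open>V\<close> is simple, all \<open>1 \<otimes> \<dots> \<otimes> 1 \<otimes> w\<close> lie in \<open>U\<close>, and
  multiplication by the variables produces the whole space (\<open>submodule_eq_tensor_space\<close>).

  Conversely suppose \<open>\<lambda>\<^sub>i = \<lambda>\<^sub>j\<close> with \<open>i \<noteq> j\<close>. Let \<open>\<tau>\<^sub>k\<close> be the shift of the first variable of the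
  \<open>k\<close>-th factor by \<open>-1\<close>. The kernel of \<open>\<tau>\<^sub>i - \<tau>\<^sub>j\<close>, that is, the tensors depending on the first
  variables of the factors \<open>i\<close> and \<open>j\<close> only through their sum, is a submodule: \<open>\<tau>\<^sub>k\<close> commutes with the
  action up to the term \<open>- \<lambda>\<^sub>k\<^sup>n \<tau>\<^sub>k\<^sup>n\<^sup>+\<^sup>1\<close> for \<open>L\<^sub>n\<close>, which depends on the factor only through \<open>\<lambda>\<^sub>k\<close>
  and \<open>\<tau>\<^sub>k\<close>. It is neither zero nor everything (\<open>not_simple_if_repeated\<close>). The argument does not
  distinguish between \<open>\<Omega>\<close> and \<open>\<Gamma>\<close>.
\<close>

section \<open>Sequences annihilated by iterated differences\<close>

text \<open>The forward difference of a sequence indexed by the integers.\<close>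

definition fdiff :: "(int \<Rightarrow> 'w::complex_vector) \<Rightarrow> int \<Rightarrow> 'w" where
  "fdiff g n = g (n + 1) - g n"

text \<open>
  Polynomial dependence on the index, expressed without coefficients: some iterated difference
  vanishes.
\<close>

definition poly_seq :: "(int \<Rightarrow> 'w::complex_vector) \<Rightarrow> bool" where
  "poly_seq g \<longleftrightarrow> (\<exists>d. (fdiff ^^ d) g = (\<lambda>_. 0))"

lemma fdiff_funpow_linear:
  assumes "linearC f"
  shows "(fdiff ^^ d) (\<lambda>n. f (g n)) = (\<lambda>n. f ((fdiff ^^ d) g n))"
  by (induction d) (simp_all add: fdiff_def linearC_diff[OF assms] fun_eq_iff)

lemma fdiff_funpow_add:
  "(fdiff ^^ d) (\<lambda>n. g n + h n) = (\<lambda>n. (fdiff ^^ d) g n + (fdiff ^^ d) h n)"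
  by (induction d) (simp_all add: fdiff_def fun_eq_iff)

lemma fdiff_funpow_diff:
  "(fdiff ^^ d) (\<lambda>n. g n - h n) = (\<lambda>n. (fdiff ^^ d) g n - (fdiff ^^ d) h n)"
  by (induction d) (simp_all add: fdiff_def fun_eq_iff)

lemma fdiff_funpow_translate: "(fdiff ^^ d) (\<lambda>n. g (n + 1)) = (\<lambda>n. (fdiff ^^ d) g (n + 1))"
  by (induction d) (simp_all add: fdiff_def fun_eq_iff)

lemma fdiff_funpow_0: "(fdiff ^^ d) (\<lambda>_. 0) = (\<lambda>_. 0)"
  by (induction d) (simp_all add: fdiff_def fun_eq_iff)

lemma linearC_scaleC: "linearC (\<lambda>v. c *\<^sub>C v)"
  by (simp add: linearC_def scaleC_add_right mult.commute)

lemma fdiff_funpow_scale: "(fdiff ^^ d) (\<lambda>n. c *\<^sub>C g n) = (\<lambda>n. c *\<^sub>C (fdiff ^^ d) g n)"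
  by (rule fdiff_funpow_linear[OF linearC_scaleC])

lemma fdiff_funpow_le:
  assumes "(fdiff ^^ d) g = (\<lambda>_. 0)" "d \<le> e"
  shows "(fdiff ^^ e) g = (\<lambda>_. 0)"
proof -
  have "(fdiff ^^ e) g = (fdiff ^^ (e - d)) ((fdiff ^^ d) g)"
    using assms(2) by (metis add.commute comp_apply funpow_add le_add_diff_inverse)
  then show ?thesis by (simp add: assms(1) fdiff_funpow_0)
qed

lemma poly_seq_const: "poly_seq (\<lambda>_. v)"
  unfolding poly_seq_def by (rule exI[of _ 1]) (simp add: fdiff_def fun_eq_iff)

lemma poly_seq_linear: "linearC f \<Longrightarrow> poly_seq g \<Longrightarrow> poly_seq (\<lambda>n. f (g n))"
  unfolding poly_seq_def using fdiff_funpow_linear[of f _ g] linearC_0[of f] by metis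

lemma poly_seq_add:
  assumes "poly_seq g" "poly_seq h"
  shows "poly_seq (\<lambda>n. g n + h n)"
proof -
  obtain d e where "(fdiff ^^ d) g = (\<lambda>_. 0)" "(fdiff ^^ e) h = (\<lambda>_. 0)"
    using assms unfolding poly_seq_def by blast
  then have "(fdiff ^^ max d e) (\<lambda>n. g n + h n) = (\<lambda>_. 0)"
    by (simp add: fdiff_funpow_add fdiff_funpow_le[of d g] fdiff_funpow_le[of e h])
  then show ?thesis unfolding poly_seq_def by blast
qed

lemma poly_seq_times_index:
  assumes "poly_seq g"
  shows "poly_seq (\<lambda>n. of_int n *\<^sub>C g n)"
proof -
  have *: "(fdiff ^^ Suc d) (\<lambda>n. of_int n *\<^sub>C g n) = (\<lambda>_. 0)" if "(fdiff ^^ d) g = (\<lambda>_. 0)"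
    for d and g :: "int \<Rightarrow> 'a"
    using that
  proof (induction d arbitrary: g)
    case 0
    then show ?case by (simp add: fdiff_def fun_eq_iff)
  next
    case (Suc d)
    have 1: "(fdiff ^^ d) (fdiff g) = (\<lambda>_. 0)"
      using Suc.prems by (simp add: funpow_swap1)
    have "fdiff (\<lambda>n. of_int n *\<^sub>C g n) = (\<lambda>n. of_int n *\<^sub>C fdiff g n + g (n + 1))"
      by (simp add: fdiff_def fun_eq_iff scaleC_add_left scaleC_one cvs.scale_right_diff_distrib)
    then have "(fdiff ^^ Suc (Suc d)) (\<lambda>n. of_int n *\<^sub>C g n)
        = (fdiff ^^ Suc d) (\<lambda>n. of_int n *\<^sub>C fdiff g n + g (n + 1))"
      by (subst funpow_Suc_right) simp
    also have "\<dots> = (\<lambda>_. 0)"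
      unfolding fdiff_funpow_add fdiff_funpow_translate[of _ g] Suc.IH[OF 1] Suc.prems by simp
    finally show ?case .
  qed
  show ?thesis using assms * unfolding poly_seq_def by blast
qed

text \<open>
  A polynomial sequence is determined by its values at large indices: running backwards,
  \<open>g n = g (n + 1) - fdiff g n\<close>, and the difference is covered by induction on the degree. This
  passes from large \<open>n\<close> to all integers \<open>n\<close>.
\<close>

lemma poly_seq_in_subspace:
  assumes U: "cvs.subspace U" and "poly_seq g" and "\<And>n. n \<ge> N \<Longrightarrow> g n \<in> U"
  shows "g n \<in> U"
proof -
  obtain d where "(fdiff ^^ d) g = (\<lambda>_. 0)" using assms(2) unfolding poly_seq_def by blast
  then show ?thesis using assms(3)
  proof (induction d arbitrary: g n)
    case 0
    then show ?case by (simp add: cvs.subspace_0[OF U])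
  next
    case (Suc d)
    have "(fdiff ^^ d) (fdiff g) = (\<lambda>_. 0)"
      using Suc.prems(1) by (simp add: funpow_swap1)
    then have d: "fdiff g n \<in> U" for n
      by (rule Suc.IH) (simp add: fdiff_def cvs.subspace_diff[OF U] Suc.prems(2))
    show ?case
    proof (cases "n \<ge> N")
      case False
      then have "n \<le> N" by simp
      then show ?thesis
      proof (induction n rule: int_le_induct)
        case base
        show ?case by (simp add: Suc.prems(2))
      next
        case (step i)
        then have "g i - fdiff g (i - 1) \<in> U" using d cvs.subspace_diff[OF U] by blast
        then show ?case by (simp add: fdiff_def)
      qed
    qed (rule Suc.prems(2))
  qed
qed

lemma subspace_scaleC_cancel:
  assumes "cvs.subspace U" "c *\<^sub>C v \<in> U" "c \<noteq> 0"
  shows "v \<in> U"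
proof -
  have "inverse c *\<^sub>C (c *\<^sub>C v) \<in> U" by (rule cvs.subspace_scale[OF assms(1,2)])
  then show ?thesis using assms(3) by (simp add: scaleC_one)
qed

text \<open>
  Modulo \<open>U\<close> the first assumption reads \<open>(a - b) p = - a (fdiff p)\<close>, so \<open>p\<close> is, up to a constant,
  an arbitrarily high difference of itself.
\<close>

lemma twisted_difference_in_subspace:
  assumes U: "cvs.subspace U" and ab: "a \<noteq> b"
    and "\<And>n. n \<ge> N \<Longrightarrow> a *\<^sub>C p (n + 1) - b *\<^sub>C p n \<in> U"
    and "\<And>n. n \<ge> N \<Longrightarrow> (fdiff ^^ d) p n \<in> U"
    and "n \<ge> N"
  shows "p n \<in> U"
  using assms(3-)
proof (induction d arbitrary: p n)
  case 0
  then show ?case by simp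
next
  case (Suc d)
  have "fdiff p n \<in> U"
  proof (rule Suc.IH)
    show "a *\<^sub>C fdiff p (n + 1) - b *\<^sub>C fdiff p n \<in> U" if "n \<ge> N" for n
    proof -
      have "(a *\<^sub>C p (n + 1 + 1) - b *\<^sub>C p (n + 1)) - (a *\<^sub>C p (n + 1) - b *\<^sub>C p n) \<in> U"
        using that by (intro cvs.subspace_diff[OF U] Suc.prems(1)) auto
      moreover have "a *\<^sub>C (x - y) - b *\<^sub>C (y - z) = (a *\<^sub>C x - b *\<^sub>C y) - (a *\<^sub>C y - b *\<^sub>C z)"
        for x y z :: 'a
        by (simp add: cvs.scale_right_diff_distrib)
      ultimately show ?thesis unfolding fdiff_def by simp
    qed
    show "(fdiff ^^ d) (fdiff p) n \<in> U" if "n \<ge> N" for n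
      using Suc.prems(2)[OF that] by (simp add: funpow_swap1)
  qed (rule Suc.prems(3))
  moreover have "(a - b) *\<^sub>C p n = (a *\<^sub>C p (n + 1) - b *\<^sub>C p n) - a *\<^sub>C fdiff p n"
    by (simp add: fdiff_def cvs.scale_right_diff_distrib cvs.scale_left_diff_distrib)
  ultimately have "(a - b) *\<^sub>C p n \<in> U"
    by (simp add: cvs.subspace_diff[OF U] cvs.subspace_scale[OF U] Suc.prems(1,3))
  then show ?case using ab subspace_scaleC_cancel[OF U] by fastforce
qed

text \<open>
  The induction runs over \<open>K\<close> and, for a chosen \<open>c \<in> K\<close>, over the degree of \<open>p c\<close> modulo \<open>U\<close>.
  Passing from the sum \<open>F\<close> to \<open>F (n + 1) - lam c *\<^sub>C F n\<close> lowers the degree of the term at \<open>c\<close>; the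
  other terms become the twisted differences above. Stating the vanishing of the differences
  only modulo \<open>U\<close> and for large indices makes the induction self-contained.
\<close>

lemma exponential_separation_mod:
  fixes lam :: "'k \<Rightarrow> complex" and p :: "'k \<Rightarrow> int \<Rightarrow> 'w::complex_vector"
  assumes U: "cvs.subspace U" and "finite K" "inj_on lam K" "\<And>k. k \<in> K \<Longrightarrow> lam k \<noteq> 0"
    and "\<And>k. k \<in> K \<Longrightarrow> \<exists>d. \<forall>n\<ge>N. (fdiff ^^ d) (p k) n \<in> U"
    and "\<And>n. n \<ge> N \<Longrightarrow> (\<Sum>k\<in>K. (lam k powi n) *\<^sub>C p k n) \<in> U"
  shows "\<forall>k\<in>K. \<forall>n\<ge>N. p k n \<in> U"
  using assms(2-)
proof (induction K arbitrary: p rule: finite_induct)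
  case (insert c K)
  have inj: "inj_on lam K" using insert.prems(1) by auto
  have ne: "lam k \<noteq> 0" if "k \<in> insert c K" for k using insert.prems(2) that by blast
  have nec: "lam k \<noteq> lam c" if "k \<in> K" for k
    using insert.prems(1) that insert.hyps(2) by (auto simp: inj_on_def)
  have key: "\<forall>k\<in>insert c K. \<forall>n\<ge>N. p k n \<in> U"
    if "\<forall>k\<in>K. \<exists>d. \<forall>n\<ge>N. (fdiff ^^ d) (p k) n \<in> U"
      "\<forall>n\<ge>N. (fdiff ^^ d) (p c) n \<in> U"
      "\<forall>n\<ge>N. (\<Sum>k\<in>insert c K. (lam k powi n) *\<^sub>C p k n) \<in> U"
    for d p
    using that
  proof (induction d arbitrary: p)
    case 0
    then have c: "\<forall>n\<ge>N. p c n \<in> U" by simp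
    have "\<forall>k\<in>K. \<forall>n\<ge>N. p k n \<in> U"
    proof (rule insert.IH[OF inj ne])
      fix n assume n: "n \<ge> N"
      have "(\<Sum>k\<in>insert c K. (lam k powi n) *\<^sub>C p k n) - (lam c powi n) *\<^sub>C p c n \<in> U"
        using 0 c n by (intro cvs.subspace_diff[OF U] cvs.subspace_scale[OF U]) auto
      then show "(\<Sum>k\<in>K. (lam k powi n) *\<^sub>C p k n) \<in> U"
        using insert.hyps by simp
    qed (use 0 in auto)
    with c show ?case by blast
  next
    case (Suc d)
    \<comment> \<open>These are the coefficients of \<open>F (n + 1) - lam c *\<^sub>C F n\<close>.\<close>
    define q where "q k n = lam k *\<^sub>C p k (n + 1) - lam c *\<^sub>C p k n" for k n
    have q_fdiff: "(fdiff ^^ e) (q k) n = lam k *\<^sub>C (fdiff ^^ e) (p k) (n + 1) - lam c *\<^sub>C (fdiff ^^ e) (p k) n"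
      for e k n
      by (simp add: q_def[abs_def] fdiff_funpow_diff fdiff_funpow_scale fdiff_funpow_translate[of _ "p k"])
    have q: "\<forall>k\<in>insert c K. \<forall>n\<ge>N. q k n \<in> U"
    proof (rule Suc.IH)
      show "\<forall>k\<in>K. \<exists>d. \<forall>n\<ge>N. (fdiff ^^ d) (q k) n \<in> U"
      proof
        fix k assume "k \<in> K"
        then obtain e where e: "\<forall>n\<ge>N. (fdiff ^^ e) (p k) n \<in> U" using Suc.prems(1) by blast
        have "\<forall>n\<ge>N. (fdiff ^^ e) (q k) n \<in> U"
          unfolding q_fdiff using e by (auto intro!: cvs.subspace_diff[OF U] cvs.subspace_scale[OF U])
        then show "\<exists>d. \<forall>n\<ge>N. (fdiff ^^ d) (q k) n \<in> U" by blast
      qed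
      show "\<forall>n\<ge>N. (fdiff ^^ d) (q c) n \<in> U"
      proof (intro allI impI)
        fix n assume "n \<ge> N"
        then have "lam c *\<^sub>C (fdiff ^^ Suc d) (p c) n \<in> U"
          using Suc.prems(2) cvs.subspace_scale[OF U] by blast
        then show "(fdiff ^^ d) (q c) n \<in> U"
          by (simp add: q_fdiff fdiff_def cvs.scale_right_diff_distrib)
      qed
      show "\<forall>n\<ge>N. (\<Sum>k\<in>insert c K. (lam k powi n) *\<^sub>C q k n) \<in> U"
      proof (intro allI impI)
        fix n assume n: "n \<ge> N"
        let ?F = "\<lambda>n. \<Sum>k\<in>insert c K. (lam k powi n) *\<^sub>C p k n"
        have "?F (n + 1) - lam c *\<^sub>C ?F n \<in> U"
          using n Suc.prems(3) by (intro cvs.subspace_diff[OF U] cvs.subspace_scale[OF U]) auto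
        also have "?F (n + 1) - lam c *\<^sub>C ?F n = (\<Sum>k\<in>insert c K. (lam k powi n) *\<^sub>C q k n)"
          unfolding cvs.scale_sum_right sum_subtractf[symmetric]
          by (intro sum.cong refl)
             (simp add: q_def cvs.scale_right_diff_distrib power_int_add ne mult.commute)
        finally show "(\<Sum>k\<in>insert c K. (lam k powi n) *\<^sub>C q k n) \<in> U" .
      qed
    qed
    have K: "p k n \<in> U" if k: "k \<in> K" and "n \<ge> N" for k n
    proof -
      obtain e where e: "\<forall>n\<ge>N. (fdiff ^^ e) (p k) n \<in> U" using Suc.prems(1) k by blast
      show ?thesis
        by (rule twisted_difference_in_subspace[OF U nec[OF k], of N _ e])
           (use q k e that in \<open>auto simp: q_def\<close>)
    qed
    have "p c n \<in> U" if n: "n \<ge> N" for n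
    proof -
      have "(\<Sum>k\<in>insert c K. (lam k powi n) *\<^sub>C p k n) - (\<Sum>k\<in>K. (lam k powi n) *\<^sub>C p k n) \<in> U"
      proof (rule cvs.subspace_diff[OF U])
        show "(\<Sum>k\<in>insert c K. (lam k powi n) *\<^sub>C p k n) \<in> U" using Suc.prems(3) n by blast
        show "(\<Sum>k\<in>K. (lam k powi n) *\<^sub>C p k n) \<in> U"
          using K n by (intro cvs.subspace_sum[OF U] cvs.subspace_scale[OF U]) auto
      qed
      then have "(lam c powi n) *\<^sub>C p c n \<in> U" using insert.hyps by simp
      then show ?thesis by (rule subspace_scaleC_cancel[OF U]) (simp add: ne)
    qed
    with K show ?case by blast
  qed
  obtain d where "\<forall>n\<ge>N. (fdiff ^^ d) (p c) n \<in> U" using insert.prems(3) by blast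
  then show ?case using insert.prems by (intro key) auto
qed simp

lemma exponential_separation:
  fixes lam :: "'k \<Rightarrow> complex" and p :: "'k \<Rightarrow> int \<Rightarrow> 'w::complex_vector"
  assumes U: "cvs.subspace U" and "finite K" "inj_on lam K" "\<And>k. k \<in> K \<Longrightarrow> lam k \<noteq> 0"
    and p: "\<And>k. k \<in> K \<Longrightarrow> poly_seq (p k)"
    and "\<And>n. n \<ge> N \<Longrightarrow> (\<Sum>k\<in>K. (lam k powi n) *\<^sub>C p k n) \<in> U"
    and "k \<in> K"
  shows "p k n \<in> U"
proof (rule poly_seq_in_subspace[OF U p[OF assms(7)]])
  have "\<forall>k\<in>K. \<forall>n\<ge>N. p k n \<in> U"
  proof (rule exponential_separation_mod[OF U assms(2-4) _ assms(6)])
    fix k assume "k \<in> K"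
    then obtain d where "(fdiff ^^ d) (p k) = (\<lambda>_. 0)" using p unfolding poly_seq_def by blast
    then show "\<exists>d. \<forall>n\<ge>N. (fdiff ^^ d) (p k) n \<in> U" using cvs.subspace_0[OF U] by metis
  qed auto
  then show "p k n \<in> U" if "n \<ge> N" for n using that assms(7) by blast
qed

section \<open>Operators on a single tensor factor\<close>

text \<open>
  \<open>map_slot k f\<close> applies \<open>f\<close> to the \<open>k\<close>-th polynomial factor (counted from \<open>0\<close>) and \<open>map_last f\<close>
  applies \<open>f\<close> to the last factor; on tensors with at most \<open>k\<close> factors in front of the last one,
  \<open>map_slot k f\<close> is the identity. Both are meaningful for linear \<open>f\<close>.
\<close>

definition map_slot ::
  "nat \<Rightarrow> ('a \<Rightarrow> 'a) \<Rightarrow> ('a::complex_vector, 'v::complex_vector) tensor \<Rightarrow> ('a, 'v) tensor" where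
  "map_slot k f X = lin_ext (\<lambda>(ps, v). pure_tensor (ps[k := f (ps ! k)]) v) (rep_tensor X)"

definition map_last ::
  "('v \<Rightarrow> 'v) \<Rightarrow> ('a::complex_vector, 'v::complex_vector) tensor \<Rightarrow> ('a, 'v) tensor" where
  "map_last f X = lin_ext (\<lambda>(ps, v). pure_tensor ps (f v)) (rep_tensor X)"

lemma multilinearC_map_slot:
  assumes f: "linearC f"
  shows "multilinearC (\<lambda>(ps, v). pure_tensor (ps[k := f (ps ! k)]) v)"
  unfolding multilinearC_def
proof (intro conjI allI impI)
  fix ps :: "'a list" and v :: 'b and i assume i: "i < length ps"
  consider "k = i" | "k \<noteq> i" by blast
  then have "linearC (\<lambda>p. pure_tensor (ps[i := p, k := f (ps[i := p] ! k)]) v)"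
  proof cases
    case 1
    then show ?thesis using i linearC_comp[OF multilinear_pure(1)[OF i] f] by simp
  next
    case 2
    then have "(\<lambda>p. pure_tensor (ps[i := p, k := f (ps[i := p] ! k)]) v) =
      (\<lambda>p. pure_tensor ((ps[k := f (ps ! k)])[i := p]) v)"
      by (simp add: list_update_swap)
    then show ?thesis using i by (simp add: multilinear_pure(1))
  qed
  then show "linearC (\<lambda>p. case (ps[i := p], v) of (ps, v) \<Rightarrow> pure_tensor (ps[k := f (ps ! k)]) v)"
    by simp
qed (simp add: multilinear_pure(2))

lemma
  assumes "linearC f"
  shows linearC_map_slot: "linearC (map_slot k f :: ('a::complex_vector, 'v::complex_vector) tensor \<Rightarrow> _)"
    and map_slot_pure [simp]:
      "map_slot k f (pure_tensor ps v) = pure_tensor (ps[k := f (ps ! k)]) (v :: 'v)"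
  using tensor_lift[OF multilinearC_map_slot[OF assms, of k, where 'b = 'v]]
  by (simp_all add: map_slot_def[abs_def])

lemma
  assumes "linearC f"
  shows linearC_map_last: "linearC (map_last f :: ('a::complex_vector, 'v::complex_vector) tensor \<Rightarrow> _)"
    and map_last_pure [simp]:
      "map_last f (pure_tensor (ps :: 'a list) v) = pure_tensor ps (f v)"
proof -
  have "multilinearC (\<lambda>(ps :: 'a list, v). pure_tensor ps (f v))"
    by (simp add: multilinearC_def multilinear_pure(1) linearC_comp[OF multilinear_pure(2) assms])
  from tensor_lift[OF this] show "linearC (map_last f :: ('a, 'v) tensor \<Rightarrow> _)"
    "map_last f (pure_tensor (ps :: 'a list) v) = pure_tensor ps (f v)"
    by (simp_all add: map_last_def[abs_def])
qed

lemma pure_in_tensor_space: "length ps = r \<Longrightarrow> pure_tensor ps v \<in> tensor_space r"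
  unfolding tensor_space_def by (intro cvs.span_base) blast

lemma subspace_tensor_space: "cvs.subspace (tensor_space r)"
  unfolding tensor_space_def by (rule cvs.subspace_span)

lemma tensor_space_induct [consumes 1, case_names zero pure add]:
  assumes "X \<in> tensor_space r" "Q 0"
    and "\<And>ps v. length ps = r \<Longrightarrow> Q (pure_tensor ps v)"
    and "\<And>X Y. Q X \<Longrightarrow> Q Y \<Longrightarrow> Q (X + Y)"
  shows "Q X"
  using assms(1) unfolding tensor_space_def
proof (induction rule: cvs.span_induct_alt)
  case (step c X Y)
  then obtain ps v where "X = pure_tensor ps v" "length ps = r" by blast
  moreover from this have "c *\<^sub>C X = pure_tensor ps (c *\<^sub>C v)"
    by (simp add: linearC_scale[OF multilinear_pure(2)])
  ultimately show ?case using assms(3,4) step.IH by simp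
qed (rule assms(2))

lemma map_slot_closed:
  assumes "linearC f" "X \<in> tensor_space r"
  shows "map_slot k f X \<in> tensor_space r"
  using assms(2)
  by (induction rule: tensor_space_induct)
     (simp_all add: assms(1) linearC_0[OF linearC_map_slot] linearC_add[OF linearC_map_slot]
        cvs.subspace_0[OF subspace_tensor_space] cvs.subspace_add[OF subspace_tensor_space]
        pure_in_tensor_space)

lemma map_slot_id:
  assumes "X \<in> tensor_space r"
  shows "map_slot k (\<lambda>p. p) X = X"
  by (rule tensor_space_ext[OF linearC_map_slot _ _ assms]) (simp_all add: linearC_def)

lemma map_slot_comp:
  assumes "linearC f" "linearC g" "k < r" "X \<in> tensor_space r"
  shows "map_slot k f (map_slot k g X) = map_slot k (\<lambda>p. f (g p)) X"
  by (rule tensor_space_ext[OF linearC_comp[OF linearC_map_slot linearC_map_slot] linearC_map_slot _ assms(4)])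
     (simp_all add: assms linearC_comp)

lemma map_slot_commute:
  assumes "linearC f" "linearC g" "k \<noteq> l" "X \<in> tensor_space r"
  shows "map_slot k f (map_slot l g X) = map_slot l g (map_slot k f X)"
  by (rule tensor_space_ext[OF linearC_comp[OF linearC_map_slot linearC_map_slot]
        linearC_comp[OF linearC_map_slot linearC_map_slot] _ assms(4)])
     (use assms in \<open>simp_all add: list_update_swap\<close>)

lemma map_slot_last_commute:
  assumes "linearC f" "linearC g" "X \<in> tensor_space r"
  shows "map_slot k f (map_last g X) = map_last g (map_slot k f X)"
  by (rule tensor_space_ext[OF linearC_comp[OF linearC_map_slot linearC_map_last]
        linearC_comp[OF linearC_map_last linearC_map_slot] _ assms(3)])
     (simp_all add: assms)

lemma linearC_diff_fun: "linearC f \<Longrightarrow> linearC g \<Longrightarrow> linearC (\<lambda>x. f x - g x)"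
  by (simp add: linearC_def cvs.scale_right_diff_distrib)

lemma map_slot_add:
  assumes "linearC f" "linearC g" "k < r" "X \<in> tensor_space r"
  shows "map_slot k (\<lambda>p. f p + g p) X = map_slot k f X + map_slot k g X"
  by (rule tensor_space_ext[OF linearC_map_slot linearC_plus[OF linearC_map_slot linearC_map_slot] _ assms(4)])
     (use assms in \<open>simp_all add: linearC_plus linearC_add[OF multilinear_pure(1)]\<close>)

lemma map_slot_diff:
  assumes "linearC f" "linearC g" "k < r" "X \<in> tensor_space r"
  shows "map_slot k (\<lambda>p. f p - g p) X = map_slot k f X - map_slot k g X"
  by (rule tensor_space_ext[OF linearC_map_slot linearC_diff_fun[OF linearC_map_slot linearC_map_slot] _ assms(4)])
     (use assms in \<open>simp_all add: linearC_diff_fun linearC_diff[OF multilinear_pure(1)]\<close>)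

lemma map_slot_scale:
  assumes "linearC f" "k < r" "X \<in> tensor_space r"
  shows "map_slot k (\<lambda>p. c *\<^sub>C f p) X = c *\<^sub>C map_slot k f X"
  by (rule tensor_space_ext[OF linearC_map_slot linearC_comp[OF linearC_scaleC linearC_map_slot] _ assms(3)])
     (use assms in \<open>simp_all add: linearC_comp[OF linearC_scaleC] linearC_scale[OF multilinear_pure(1)]\<close>)

lemma tensor_act_eq_slots:
  assumes "\<And>k. linearC (rho k x)" "linearC (act x)" "X \<in> tensor_space r"
  shows "tensor_act rho act x X = (\<Sum>k<r. map_slot k (rho k x) X) + map_last (act x) X"
  by (rule tensor_space_ext[OF linearC_tensor_act _ _ assms(3)])
     (auto simp: assms tensor_act_pure[where rho = rho and act = act, OF assms(1,2)]
       intro!: linearC_plus linearC_sum' linearC_map_slot linearC_map_last)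

section \<open>Polynomials in two variables and their shifts\<close>

text \<open>
  Every polynomial is obtained from \<open>1\<close> by linear combinations and multiplication by the variables.
\<close>

lemma poly2_induct [case_names one add scale var1 var2]:
  assumes one: "Q 1" and add: "\<And>f g. Q f \<Longrightarrow> Q g \<Longrightarrow> Q (f + g)"
    and scale: "\<And>c f. Q f \<Longrightarrow> Q (c *\<^sub>C f)"
    and var1: "\<And>f. Q f \<Longrightarrow> Q (var1 * f)" and var2: "\<And>f. Q f \<Longrightarrow> Q (var2 * f)"
  shows "Q f"
proof -
  have Q0: "Q 0" using scale[OF one, of 0] by simp
  have "Q [:a:]" for a :: "complex poly"
  proof (induction a)
    case (pCons c a)
    have eq: "[:pCons c a:] = c *\<^sub>C 1 + var1 * [:a:]"
      by (rule eval2_eqI) (simp add: scaleC_poly2 const2_def var1_def eval2_def)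
    show ?case unfolding eq by (intro add scale one var1 pCons.IH)
  qed (simp add: Q0)
  note const = this
  show ?thesis
  proof (induction f)
    case (pCons a f)
    have eq: "pCons a f = [:a:] + var2 * f"
      by (simp add: var2_def)
    show ?case unfolding eq by (intro add const var2 pCons.IH)
  qed (rule Q0)
qed

lemma eval2_1 [simp]: "eval2 1 a b = 1"
  by (simp add: eval2_def)

lemma linearC_shift2: "linearC (shift2 a b)"
  by (auto simp: linearC_def intro!: eval2_eqI)

lemma linearC_times: "linearC (\<lambda>f. g * f :: complex poly poly)"
  by (auto simp: linearC_def algebra_simps intro!: eval2_eqI)

lemma shift2_shift2: "shift2 a b (shift2 c d f) = shift2 (a + c) (b + d) f"
  by (rule eval2_eqI) (simp add: algebra_simps)

lemma shift2_zero [simp]: "shift2 0 0 f = f"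
  by (rule eval2_eqI) simp

lemma poly_seq_shift2: "poly_seq (\<lambda>n. shift2 (of_int n * a) (of_int n * b) f)"
proof (induction f rule: poly2_induct)
  case one
  have "shift2 (of_int n * a) (of_int n * b) 1 = 1" for n by (rule eval2_eqI) simp
  then show ?case by (simp add: poly_seq_const)
next
  case (add f g)
  then show ?case by (simp add: linearC_add[OF linearC_shift2] poly_seq_add)
next
  case (scale c f)
  then show ?case by (simp add: linearC_scale[OF linearC_shift2] poly_seq_linear[OF linearC_scaleC])
next
  case (var1 f)
  let ?g = "\<lambda>n. shift2 (of_int n * a) (of_int n * b) f"
  have "shift2 (of_int n * a) (of_int n * b) (var1 * f) = var1 * ?g n + a *\<^sub>C (of_int n *\<^sub>C ?g n)" for n
    by (rule eval2_eqI) (simp add: algebra_simps)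
  then show ?case
    by (simp only:)
       (intro poly_seq_add poly_seq_linear[OF linearC_times] poly_seq_linear[OF linearC_scaleC]
          poly_seq_times_index var1)
next
  case (var2 f)
  let ?g = "\<lambda>n. shift2 (of_int n * a) (of_int n * b) f"
  have "shift2 (of_int n * a) (of_int n * b) (var2 * f) = var2 * ?g n + b *\<^sub>C (of_int n *\<^sub>C ?g n)" for n
    by (rule eval2_eqI) (simp add: algebra_simps)
  then show ?case
    by (simp only:)
       (intro poly_seq_add poly_seq_linear[OF linearC_times] poly_seq_linear[OF linearC_scaleC]
          poly_seq_times_index var2)
qed

text \<open>The operator \<open>shift - 1\<close>, which lowers the total degree.\<close>

definition shift_diff :: "complex \<Rightarrow> complex \<Rightarrow> complex poly poly \<Rightarrow> complex poly poly" where
  "shift_diff a b f = shift2 a b f - f"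

lemma linearC_shift_diff: "linearC (shift_diff a b)"
  unfolding shift_diff_def[abs_def] by (intro linearC_diff_fun linearC_shift2) (simp add: linearC_def)

lemma shift_diff_nilpotent: "\<exists>d. (shift_diff a b ^^ d) f = 0"
proof -
  have *: "(fdiff ^^ d) (\<lambda>n. shift2 (of_int n * a) (of_int n * b) f)
      = (\<lambda>n. shift2 (of_int n * a) (of_int n * b) ((shift_diff a b ^^ d) f))" for d
  proof (induction d)
    case (Suc d)
    have "shift2 (of_int (n + 1) * a) (of_int (n + 1) * b) h - shift2 (of_int n * a) (of_int n * b) h
        = shift2 (of_int n * a) (of_int n * b) (shift_diff a b h)" for n h
      unfolding shift_diff_def linearC_diff[OF linearC_shift2] shift2_shift2 by (simp add: distrib_right)
    note step = this
    show ?case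
      unfolding funpow.simps comp_apply Suc.IH by (rule ext) (unfold fdiff_def, rule step)
  qed simp
  obtain d where "(fdiff ^^ d) (\<lambda>n. shift2 (of_int n * a) (of_int n * b) f) = (\<lambda>_. 0)"
    using poly_seq_shift2[of a b f] unfolding poly_seq_def by blast
  from fun_cong[OF this[unfolded *], of 0] have "(shift_diff a b ^^ d) f = 0" by simp
  then show ?thesis by blast
qed

text \<open>The projection of a polynomial to its constant term.\<close>

definition const_part :: "complex poly poly \<Rightarrow> complex poly poly" where
  "const_part f = eval2 f 0 0 *\<^sub>C 1"

lemma linearC_const_part: "linearC const_part"
  by (auto simp: linearC_def const_part_def scaleC_add_left)

lemma poly_eq_0_of_nats:
  fixes p :: "'a :: {idom, ring_char_0} poly"
  assumes "\<And>n. poly p (of_nat n * c) = 0" "c \<noteq> 0"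
  shows "p = 0"
proof (rule ccontr)
  assume "p \<noteq> 0"
  then have "finite {x. poly p x = 0}" by (rule poly_roots_finite)
  moreover have "range (\<lambda>n::nat. of_nat n * c) \<subseteq> {x. poly p x = 0}" using assms by auto
  ultimately have "finite (range (\<lambda>n::nat. of_nat n * c :: 'a))" by (rule rev_finite_subset)
  then have "finite (UNIV :: nat set)" by (rule finite_imageD) (use assms(2) in \<open>simp add: inj_def\<close>)
  then show False by simp
qed

lemma shift_invariant_eq_0:
  assumes 1: "shift_diff (-1) e f = 0" and 2: "shift_diff 0 e f = 0" and e: "e \<noteq> 0" and 0: "eval2 f 0 0 = 0"
  shows "f = 0"
proof -
  have s1: "eval2 f (a - 1) (b + e) = eval2 f a b" and s2: "eval2 f a (b + e) = eval2 f a b" for a b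
    using arg_cong[OF 1, of "\<lambda>g. eval2 g a b"] arg_cong[OF 2, of "\<lambda>g. eval2 g a b"]
    by (simp_all add: shift_diff_def)
  have s3: "eval2 f (a - 1) b = eval2 f a b" for a b
    using s1 s2 by metis
  have A: "eval2 f (of_nat n * (-1)) 0 = 0" for n
  proof (induction n)
    case (Suc n)
    have "of_nat (Suc n) * (-1) = of_nat n * (-1) - (1 :: complex)" by simp
    then show ?case using Suc s3[of "of_nat n * (-1)" 0] by metis
  qed (simp add: 0)
  have B: "eval2 f (of_nat n * (-1)) (of_nat m * e) = 0" for n m
  proof (induction m)
    case (Suc m)
    then show ?case using s2[of "of_nat n * (-1)" "of_nat m * e"] by (simp add: algebra_simps)
  qed (use A[of n] in simp)
  have C: "poly f [:of_nat m * e:] = 0" for m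
    by (rule poly_eq_0_of_nats[of _ "-1"]) (use B[of _ m] in \<open>simp_all add: eval2_def\<close>)
  show ?thesis
  proof (rule poly_eq_0_of_nats)
    show "poly f (of_nat m * [:e:]) = 0" for m
      using C[of m] by (simp add: of_nat_poly mult.commute)
  qed (use e in simp)
qed

text \<open>
  The common kernel of the two operators consists of the constants. Writing this as an operator
  identity, with linear \<open>A\<close> and \<open>B\<close>, makes it applicable inside a tensor product, where it shows
  that a tensor killed in one slot by both operators is constant in that slot.
\<close>

lemma shift_diff_left_inverse:
  assumes "e \<noteq> 0"
  obtains A B where "linearC A" "linearC B"
    "\<And>f. f - const_part f = A (shift_diff (-1) e f) + B (shift_diff 0 e f)"
proof -
  interpret vs: vector_space_pair "scaleC :: complex \<Rightarrow> complex poly poly \<Rightarrow> _"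
      "scaleC :: complex \<Rightarrow> complex poly poly poly \<Rightarrow> _"
    by unfold_locales
  have lin: "Vector_Spaces.linear scaleC scaleC f \<longleftrightarrow> linearC f"
    for f :: "'a::complex_vector \<Rightarrow> 'b::complex_vector"
    using cvs.vector_space_axioms[where 'a = 'a] cvs.vector_space_axioms[where 'a = 'b]
    by (simp add: Vector_Spaces.linear_iff linearC_def)
  have scale_pCons: "c *\<^sub>C pCons a p = pCons (c *\<^sub>C a) (c *\<^sub>C p)"
    for c and a :: "complex poly poly" and p
    by (simp add: poly_eq_iff scaleC_poly.rep_eq coeff_pCons split: nat.split)
  \<comment> \<open>Pairs of polynomials are encoded as polynomials of degree at most one over them.\<close>
  define L where "L f = [:shift_diff (-1) e f, shift_diff 0 e f:]" for f
  define S where "S = {f. eval2 f 0 0 = 0}"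
  have L: "linearC L"
    using linearC_shift_diff[of "-1" e] linearC_shift_diff[of 0 e] unfolding L_def[abs_def]
    by (simp add: linearC_def scale_pCons)
  have S: "cvs.subspace S"
    by (auto simp: S_def cvs.subspace_def)
  have "f = g" if "f \<in> S" "g \<in> S" "L f = L g" for f g
  proof -
    have L0: "L (f - g) = 0" using that(3) by (simp add: linearC_diff[OF L])
    have "f - g = 0"
    proof (rule shift_invariant_eq_0)
      show "shift_diff (-1) e (f - g) = 0" "shift_diff 0 e (f - g) = 0" using L0 by (simp_all add: L_def)
      show "eval2 (f - g) 0 0 = 0" using that(1,2) by (simp add: S_def)
    qed (rule assms)
    then show ?thesis by simp
  qed
  then have "inj_on L S" by (auto intro: inj_onI)
  with vs.linear_exists_left_inverse_on[of L S] L S obtain g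
    where g: "Vector_Spaces.linear scaleC scaleC g" "\<And>f. f \<in> S \<Longrightarrow> g (L f) = f"
    by (auto simp: lin)
  from g(1) have gl: "linearC g" using lin by blast
  show ?thesis
  proof
    show "linearC (\<lambda>p. g [:p:])" "linearC (\<lambda>p. g [:0, p:])"
      by (rule linearC_comp[OF gl], simp add: linearC_def scale_pCons)+
    fix f
    have "L (const_part f) = 0"
    proof -
      have "shift_diff a b (const_part f) = 0" for a b
        by (rule eval2_eqI) (simp add: shift_diff_def const_part_def)
      then show ?thesis by (simp add: L_def)
    qed
    then have "L (f - const_part f) = [:shift_diff (-1) e f:] + [:0, shift_diff 0 e f:]"
      by (simp add: linearC_diff[OF L]) (simp add: L_def)
    moreover have "f - const_part f \<in> S" by (simp add: S_def const_part_def)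
    ultimately show "f - const_part f = g [:shift_diff (-1) e f:] + g [:0, shift_diff 0 e f:]"
      using g(2) linearC_add[OF gl] by metis
  qed
qed

section \<open>The action on one polynomial factor\<close>

text \<open>
  Both kinds of factor at once: \<open>factor_act True\<close> is \<open>\<Omega>\<close> and \<open>factor_act False\<close> is \<open>\<Gamma>\<close>. They differ
  by a sign, \<open>factor_sign\<close>, and by the exchange of \<open>I\<close> and \<open>J\<close>.
\<close>

definition factor_act ::
  "bool \<Rightarrow> complex \<Rightarrow> complex \<Rightarrow> complex \<Rightarrow> gca \<Rightarrow> complex poly poly \<Rightarrow> complex poly poly" where
  "factor_act om = (if om then Omega_act else Gamma_act)"

definition factor_sign :: "bool \<Rightarrow> complex" where
  "factor_sign om = (if om then -1 else 1)"

lemma factor_act_basis: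
  "factor_act om lam sig eta (basis_vec (gL n)) f =
     (lam powi n) *\<^sub>C (var1 * shift2 (- of_int n) 0 f
        + of_int n *\<^sub>C ((const2 (factor_sign om) * var2 + const2 eta) * shift2 (- of_int n) 0 f))"
  "factor_act om lam sig eta (basis_vec (gH n)) f = (lam powi n) *\<^sub>C (var2 * shift2 (- of_int n) 0 f)"
  "factor_act om lam sig eta (basis_vec (gI n)) f =
     (if om then (lam powi n * sig) *\<^sub>C shift2 (- of_int n) (factor_sign om) f else 0)"
  "factor_act om lam sig eta (basis_vec (gJ n)) f =
     (if om then 0 else (lam powi n * sig) *\<^sub>C shift2 (- of_int n) (factor_sign om) f)"
  by (rule eval2_eqI; simp add: factor_act_def factor_sign_def Omega_act_def Gamma_act_def algebra_simps)+

lemma linearC_factor_act: "linearC (factor_act om lam sig eta x)"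
  using linearC_Omega_basis linearC_Gamma_basis
  by (auto simp: factor_act_def Omega_act_def[abs_def] Gamma_act_def[abs_def] linearC_def lin_ext_def
      scaleC_add_right sum.distrib cvs.scale_sum_right mult.commute)

lemma poly_seq_factor_act:
  assumes lam: "lam \<noteq> 0" and g: "g \<in> {gL, gH, gI, gJ}"
  shows "poly_seq (\<lambda>n. (lam powi (- n)) *\<^sub>C factor_act om lam sig eta (basis_vec (g n)) f)"
proof -
  have P: "poly_seq (\<lambda>n. shift2 (- of_int n) 0 f)" for f
    using poly_seq_shift2[of "-1" 0 f] by simp
  have unit: "lam powi (- n) * lam powi n = 1" for n
    using lam by (simp add: power_int_minus)
  have *: "(lam powi (- n)) *\<^sub>C ((lam powi n) *\<^sub>C h) = h"
    "(lam powi (- n)) *\<^sub>C ((lam powi n * sig) *\<^sub>C h) = sig *\<^sub>C h"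
    for n and h :: "complex poly poly"
    unfolding scaleC_scaleC by (simp_all add: scaleC_one unit flip: mult.assoc)
  consider "g = gL" | "g = gH" | "g = gI" | "g = gJ" using g by blast
  then show ?thesis
  proof cases
    case 1
    show ?thesis unfolding 1 factor_act_basis *
      by (intro poly_seq_add poly_seq_linear[OF linearC_times] poly_seq_times_index P)
  next
    case 2
    show ?thesis unfolding 2 factor_act_basis * by (intro poly_seq_linear[OF linearC_times] P)
  next
    case 3
    have "(lam powi (- n)) *\<^sub>C factor_act om lam sig eta (basis_vec (gI n)) f =
        (if om then sig else 0) *\<^sub>C shift2 (- of_int n) 0 (shift2 0 (factor_sign om) f)" for n
      by (simp add: factor_act_basis * shift2_shift2 del: cvs.scale_scale)
    then show ?thesis unfolding 3 by (simp add: poly_seq_linear[OF linearC_scaleC P])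
  next
    case 4
    have "(lam powi (- n)) *\<^sub>C factor_act om lam sig eta (basis_vec (gJ n)) f =
        (if om then 0 else sig) *\<^sub>C shift2 (- of_int n) 0 (shift2 0 (factor_sign om) f)" for n
      by (simp add: factor_act_basis * shift2_shift2 del: cvs.scale_scale)
    then show ?thesis unfolding 4 by (simp add: poly_seq_linear[OF linearC_scaleC P])
  qed
qed

text \<open>
  The shifts come from \<open>I\<^sub>n\<close> on \<open>\<Omega>\<close> and from \<open>J\<^sub>n\<close> on \<open>\<Gamma>\<close>; this is where \<open>\<sigma> \<noteq> 0\<close> is needed.
\<close>

lemma factor_act_shift:
  assumes "lam \<noteq> 0" "sig \<noteq> 0"
  obtains b where
    "\<And>f. shift2 (- of_int n) (factor_sign om) f
       = inverse (lam powi n * sig) *\<^sub>C factor_act om lam sig eta (basis_vec b) f"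
proof -
  define c where "c = lam powi n * sig"
  have "c \<noteq> 0" using assms by (simp add: c_def)
  then have "inverse c *\<^sub>C (c *\<^sub>C h) = h" for h :: "complex poly poly"
    by (simp add: scaleC_one)
  then show ?thesis
    by (intro that[of "if om then gI n else gJ n"]) (simp add: factor_act_basis c_def)
qed

text \<open>
  The failure of the shift of the first variable by \<open>-1\<close> to commute with the action of a basis
  element, see \<open>shift2_factor_act\<close>. It depends neither on \<open>\<sigma>\<close> and \<open>\<eta>\<close> nor on the kind of the factor.
\<close>

fun shift_defect :: "complex \<Rightarrow> gca_index \<Rightarrow> complex poly poly \<Rightarrow> complex poly poly" where
  "shift_defect lam (gL n) f = (lam powi n) *\<^sub>C shift2 (- of_int (n + 1)) 0 f"
| "shift_defect lam _ f = 0"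

lemma shift2_factor_act:
  "shift2 (-1) 0 (factor_act om lam sig eta (basis_vec b) f)
     = factor_act om lam sig eta (basis_vec b) (shift2 (-1) 0 f) - shift_defect lam b f"
  by (cases b) (auto simp: factor_act_basis algebra_simps intro!: eval2_eqI)

lemma linearC_shift_defect: "linearC (shift_defect lam b)"
  by (cases b) (auto simp: linearC_def algebra_simps intro!: eval2_eqI)

section \<open>Submodules of the tensor product\<close>

lemma gca_submodule_basisI:
  assumes M: "gca_module M act" and U: "cvs.subspace U" "U \<subseteq> M"
    and basis: "\<And>b u. u \<in> U \<Longrightarrow> act (basis_vec b) u \<in> U"
  shows "gca_submodule U M act"
  unfolding gca_submodule_def
proof (intro conjI allI ballI U)
  fix x u assume u: "u \<in> U"
  have lin: "linearC (\<lambda>x. act x u)"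
    using u U(2) M by (auto simp: linearC_def gca_module_def)
  show "act x u \<in> U"
    unfolding linearC_eq_lin_ext[OF lin, of x] lin_ext_def
    by (intro cvs.subspace_sum[OF U(1)] cvs.subspace_scale[OF U(1)] basis u)
qed

lemma funpow_linear_0_le:
  fixes F :: "'w::complex_vector \<Rightarrow> 'w"
  assumes "linearC F" "(F ^^ d) X = 0" "d \<le> e"
  shows "(F ^^ e) X = 0"
proof -
  have "(F ^^ e) X = (F ^^ (e - d)) ((F ^^ d) X)"
    using assms(3) by (metis add.commute comp_apply funpow_add le_add_diff_inverse)
  moreover have "(F ^^ n) 0 = 0" for n
    by (induction n) (simp_all add: linearC_0[OF assms(1)])
  ultimately show ?thesis by (simp add: assms(2))
qed

lemma linearC_funpow: "linearC F \<Longrightarrow> linearC (F ^^ d)" for F :: "'w::complex_vector \<Rightarrow> 'w"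
  by (induction d) (simp_all add: linearC_def)

lemma map_slot_nilpotent:
  assumes f: "linearC f" and nil: "\<And>p. \<exists>d. (f ^^ d) p = 0" and k: "k < r" and X: "X \<in> tensor_space r"
  shows "\<exists>d. (map_slot k f ^^ d) X = 0"
  using X
proof (induction rule: tensor_space_induct)
  case zero
  show ?case by (rule exI[of _ 0]) simp
next
  case (pure ps v)
  have "(map_slot k f ^^ d) (pure_tensor ps v) = pure_tensor (ps[k := (f ^^ d) (ps ! k)]) v" for d
    by (induction d) (use k pure f in simp_all)
  moreover obtain d where "(f ^^ d) (ps ! k) = 0" using nil by blast
  ultimately have "(map_slot k f ^^ d) (pure_tensor ps v) = 0"
    using linearC_0[OF multilinear_pure(1)[of k ps v]] k pure by simp
  then show ?case by blast
next
  case (add X Y)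
  then obtain d e where "(map_slot k f ^^ d) X = 0" "(map_slot k f ^^ e) Y = 0" by blast
  then have "(map_slot k f ^^ max d e) X = 0" "(map_slot k f ^^ max d e) Y = 0"
    by (auto elim: funpow_linear_0_le[OF linearC_map_slot[OF f]])
  then have "(map_slot k f ^^ max d e) (X + Y) = 0"
    by (simp add: linearC_add[OF linearC_funpow[OF linearC_map_slot[OF f]]])
  then show ?case by blast
qed

text \<open>The last non-zero iterate of \<open>F\<close> at \<open>X\<close> lies in the kernel of \<open>F\<close>.\<close>

lemma nilpotent_kernel:
  assumes "\<And>Y. Y \<in> S \<Longrightarrow> F Y \<in> S" "X \<in> S" "X \<noteq> 0" "\<exists>d. (F ^^ d) X = 0"
  shows "\<exists>Y\<in>S. Y \<noteq> 0 \<and> F Y = 0"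
proof -
  define d where "d = (LEAST d. (F ^^ d) X = 0)"
  have d: "(F ^^ d) X = 0" unfolding d_def using assms(4) by (rule LeastI_ex)
  with assms(3) obtain e where e: "d = Suc e" by (cases d) auto
  have "(F ^^ e) X \<noteq> 0"
    using not_less_Least[of e "\<lambda>d. (F ^^ d) X = 0"] e unfolding d_def[symmetric] by simp
  moreover have "(F ^^ n) X \<in> S" for n
    by (induction n) (simp_all add: assms(1,2))
  ultimately show ?thesis using d e by auto
qed

text \<open>
  The tensor product of \<open>r\<close> polynomial factors with \<open>V\<close>, the first \<open>m1\<close> of them of type \<open>\<Omega>\<close>.
\<close>

locale mixed_tensor =
  fixes m1 r :: nat and lams sigs etas :: "complex list" and act :: "gca \<Rightarrow> 'v::complex_vector \<Rightarrow> 'v"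
  assumes lam_ne: "k < r \<Longrightarrow> lams ! k \<noteq> 0" and sig_ne: "k < r \<Longrightarrow> sigs ! k \<noteq> 0"
    and V_module: "gca_module UNIV act"
    and T_is_module: "gca_module (tensor_space r) (T_act m1 lams sigs etas act)"
begin

abbreviation "T \<equiv> T_act m1 lams sigs etas act"

text \<open>The action on the \<open>k\<close>-th polynomial factor.\<close>

definition rho :: "nat \<Rightarrow> gca \<Rightarrow> complex poly poly \<Rightarrow> complex poly poly" where
  "rho k = factor_act (k < m1) (lams ! k) (sigs ! k) (etas ! k)"

lemma linearC_rho: "linearC (rho k x)"
  unfolding rho_def by (rule linearC_factor_act)

lemma linearC_act: "linearC (act x)"
  by (rule gca_module_UNIV_linear(1)[OF V_module])

lemma T_eq_slots:
  assumes "X \<in> tensor_space r"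
  shows "T x X = (\<Sum>k<r. map_slot k (rho k x) X) + map_last (act x) X"
proof -
  have "T = tensor_act rho act"
    by (simp add: T_act_def rho_def[abs_def] factor_act_def if_distrib[of "\<lambda>f. f _ _ _"] cong: if_cong)
  then show ?thesis
    using tensor_act_eq_slots[OF linearC_rho linearC_act assms] by simp
qed

end

text \<open>
  If \<open>\<tau>\<^sub>i\<close> and \<open>\<tau>\<^sub>j\<close> agree on \<open>X\<close>, then so do all their integer powers, as they are invertible and
  commute.
\<close>

lemma shift_slots_powi_eq:
  assumes X: "X \<in> tensor_space r" and ij: "i < r" "j < r" "i \<noteq> j"
    and eq: "map_slot i (shift2 (-1) 0) X = map_slot j (shift2 (-1) 0) X"
  shows "map_slot i (shift2 (- of_int n) 0) X = map_slot j (shift2 (- of_int n) 0) X"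
proof -
  let ?i = "\<lambda>a. map_slot i (shift2 a 0)" and ?j = "\<lambda>a. map_slot j (shift2 a 0)"
  note closed = map_slot_closed[OF linearC_shift2]
  have comm: "?i a (?j b X) = ?j b (?i a X)" for a b
    by (rule map_slot_commute[OF linearC_shift2 linearC_shift2 ij(3) X])
  have ii: "?i a (?i b Y) = ?i (a + b) Y" and jj: "?j a (?j b Y) = ?j (a + b) Y"
    if "Y \<in> tensor_space r" for a b Y
    using that ij by (simp_all add: map_slot_comp[OF linearC_shift2 linearC_shift2] shift2_shift2)
  have i0: "?i 0 Y = Y" "?j 0 Y = Y" if "Y \<in> tensor_space r" for Y
    using map_slot_id[OF that] by (simp_all add: shift2_zero[abs_def])
  have pos: "?i (- of_nat m) X = ?j (- of_nat m) X" for m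
  proof (induction m)
    case 0
    then show ?case using i0[OF X] by (simp add: map_slot_id[OF X])
  next
    case (Suc m)
    have "?i (- of_nat (Suc m)) X = ?i (- of_nat m) (?i (-1) X)"
      by (simp add: ii[OF X] algebra_simps)
    also have "\<dots> = ?j (-1) (?i (- of_nat m) X)" by (simp add: eq comm)
    also have "\<dots> = ?j (- of_nat (Suc m)) X" by (simp add: Suc.IH jj[OF X] algebra_simps)
    finally show ?case .
  qed
  show ?thesis
  proof (cases "n \<ge> 0")
    case True
    then show ?thesis using pos[of "nat n"] by simp
  next
    case False
    define m where "m = nat (- n)"
    have n: "- of_int n = (of_nat m :: complex)" using False by (simp add: m_def)
    have "?i (of_nat m) X = ?i (of_nat m) (?j (of_nat m) (?j (- of_nat m) X))"
      by (simp add: jj[OF X] i0[OF X])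
    also have "\<dots> = ?i (of_nat m) (?j (of_nat m) (?i (- of_nat m) X))" by (simp add: pos)
    also have "\<dots> = ?j (of_nat m) (?i (of_nat m) (?i (- of_nat m) X))"
      by (rule map_slot_commute[OF linearC_shift2 linearC_shift2 ij(3) closed[OF X]])
    also have "\<dots> = ?j (of_nat m) X" by (simp add: ii[OF X] i0[OF X])
    finally show ?thesis by (simp only: n)
  qed
qed

text \<open>
  Detected by the multilinear map that evaluates every polynomial at the origin and multiplies \<open>v\<close>
  by the values.
\<close>

lemma pure_ones_ne_0:
  assumes "v \<noteq> 0"
  shows "pure_tensor (replicate r (1 :: complex poly poly)) v \<noteq> 0"
proof
  let ?f = "\<lambda>(ps :: complex poly poly list, v :: 'a). (\<Prod>i<length ps. eval2 (ps ! i) 0 0) *\<^sub>C v"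
  have "multilinearC ?f"
    unfolding multilinearC_def
  proof (intro conjI allI impI)
    fix ps :: "complex poly poly list" and v :: 'a and i assume i: "i < length ps"
    have "(\<Prod>l<length ps. eval2 (ps[i := p] ! l) 0 0)
        = eval2 p 0 0 * (\<Prod>l\<in>{..<length ps} - {i}. eval2 (ps ! l) 0 0)" for p
      using i by (subst prod.remove[of _ i]) (auto intro!: arg_cong2[of _ _ _ _ "(*)"] prod.cong)
    then show "linearC (\<lambda>p. ?f (ps[i := p], v))"
      by (simp add: linearC_def distrib_right scaleC_add_left mult.assoc)
  next
    fix ps :: "complex poly poly list"
    show "linearC (\<lambda>v. ?f (ps, v))" by (simp add: linearC_scaleC)
  qed
  note lift = tensor_lift[OF this]
  assume "pure_tensor (replicate r (1 :: complex poly poly)) v = 0"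
  then have "?f (replicate r 1, v) = 0"
    using lift(2)[of "replicate r 1" v] linearC_0[OF lift(1)] by simp
  then show False using assms by (simp add: scaleC_one)
qed

context mixed_tensor
begin

lemma shift_slot_T:
  assumes i: "i < r" and X: "X \<in> tensor_space r"
  shows "map_slot i (shift2 (-1) 0) (T (basis_vec b) X)
    = T (basis_vec b) (map_slot i (shift2 (-1) 0) X) - map_slot i (shift_defect (lams ! i) b) X"
proof -
  let ?t = "shift2 (-1) 0 :: complex poly poly \<Rightarrow> _" and ?x = "basis_vec b"
  note t = linearC_shift2[of "-1" 0]
  have tX: "map_slot i ?t X \<in> tensor_space r" by (rule map_slot_closed[OF t X])
  have k: "map_slot i ?t (map_slot k (rho k ?x) X) = map_slot k (rho k ?x) (map_slot i ?t X)
      - (if k = i then map_slot i (shift_defect (lams ! i) b) X else 0)" if "k < r" for k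
  proof (cases "k = i")
    case True
    have "?t (rho i ?x f) = rho i ?x (?t f) - shift_defect (lams ! i) b f" for f
      by (simp add: rho_def shift2_factor_act)
    then have "map_slot i ?t (map_slot i (rho i ?x) X) = map_slot i (\<lambda>f. rho i ?x (?t f) - shift_defect (lams ! i) b f) X"
      by (simp add: map_slot_comp[OF t linearC_rho i X])
    also have "\<dots> = map_slot i (rho i ?x) (map_slot i ?t X) - map_slot i (shift_defect (lams ! i) b) X"
      by (simp add: map_slot_diff[OF linearC_comp[OF linearC_rho t] linearC_shift_defect i X]
          map_slot_comp[OF linearC_rho t i X])
    finally show ?thesis using True by simp
  next
    case False
    then show ?thesis using map_slot_commute[OF t linearC_rho _ X, of i k] by simp
  qed
  have "map_slot i ?t (T ?x X) = (\<Sum>k<r. map_slot i ?t (map_slot k (rho k ?x) X))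
      + map_last (act ?x) (map_slot i ?t X)"
    by (simp add: T_eq_slots[OF X] linearC_add[OF linearC_map_slot[OF t]] linearC_sum[OF linearC_map_slot[OF t]]
        map_slot_last_commute[OF t linearC_act X])
  also have "(\<Sum>k<r. map_slot i ?t (map_slot k (rho k ?x) X)) =
      (\<Sum>k<r. map_slot k (rho k ?x) (map_slot i ?t X)
        - (if k = i then map_slot i (shift_defect (lams ! i) b) X else 0))"
    by (intro sum.cong refl k) simp
  also have "\<dots> = (\<Sum>k<r. map_slot k (rho k ?x) (map_slot i ?t X)) - map_slot i (shift_defect (lams ! i) b) X"
    using i by (simp add: sum_subtractf)
  finally show ?thesis by (simp add: T_eq_slots[OF tX])
qed

text \<open>
  The submodule \<open>U\<close> below contains \<open>1 \<otimes> \<dots> \<otimes> 1 \<otimes> v\<close>, but not the tensor obtained from it by putting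
  the first variable into slot \<open>i\<close>.
\<close>

lemma not_simple_if_repeated:
  assumes ij: "i < r" "j < r" "i \<noteq> j" and eq: "lams ! i = lams ! j" and V0: "(UNIV :: 'v set) \<noteq> {0}"
  shows "\<not> simple_gca_module (tensor_space r) T"
proof
  let ?t = "shift2 (-1) 0 :: complex poly poly \<Rightarrow> _"
  note t = linearC_shift2[of "-1" 0]
  note tl = linearC_map_slot[OF t]
  define U :: "(complex poly poly, 'v) tensor set"
    where "U = {X \<in> tensor_space r. map_slot i ?t X = map_slot j ?t X}"
  have U: "cvs.subspace U"
    using subspace_tensor_space[of r] unfolding U_def cvs.subspace_def
    by (auto simp: linearC_0[OF tl] linearC_add[OF tl] linearC_scale[OF tl])
  have sub: "gca_submodule U (tensor_space r) T"
  proof (rule gca_submodule_basisI[OF T_is_module U])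
    fix b X assume "X \<in> U"
    then have X: "X \<in> tensor_space r" and e: "map_slot i ?t X = map_slot j ?t X"
      by (auto simp: U_def)
    have z: "map_slot l (\<lambda>_. 0) X = 0" if "l < r" for l
      using map_slot_diff[of "\<lambda>p. p" "\<lambda>p. p", OF _ _ that X] by (simp add: linearC_def)
    have "map_slot i (shift_defect (lams ! i) b) X = map_slot j (shift_defect (lams ! j) b) X"
    proof (cases b)
      case (gL n)
      have *: "map_slot l (shift_defect (lams ! l) b) X
          = (lams ! l powi n) *\<^sub>C map_slot l (shift2 (- of_int (n + 1)) 0) X" if "l < r" for l
        unfolding gL shift_defect.simps(1)[abs_def] by (rule map_slot_scale[OF linearC_shift2 that X])
      then show ?thesis
        unfolding *[OF ij(1)] *[OF ij(2)] shift_slots_powi_eq[OF X ij e, of "n + 1"] by (simp only: eq)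
    qed (use z ij in \<open>simp_all add: shift_defect.simps[abs_def]\<close>)
    then show "T (basis_vec b) X \<in> U"
      using shift_slot_T[OF ij(1) X] shift_slot_T[OF ij(2) X] e gca_module.closed[OF T_is_module X]
      by (simp add: U_def)
  qed (simp add: U_def)
  obtain v :: 'v where v: "v \<noteq> 0" using V0 by auto
  let ?one = "replicate r (1 :: complex poly poly)"
  have t1: "?t 1 = 1" and ts: "?t var1 = var1 - 1" by (rule eval2_eqI, simp)+
  have up: "?one[k := 1] = ?one" for k
    by (cases "k < r") (simp_all add: list_update_same_conv list_update_beyond)
  have up2: "?one[i := var1, j := 1] = ?one[i := var1]"
    using ij by (simp add: list_update_same_conv)
  have "pure_tensor ?one v \<in> U"
    using ij up[of i] up[of j] by (simp add: U_def pure_in_tensor_space t t1)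
  with pure_ones_ne_0[OF v] have U0: "U \<noteq> {0}" by auto
  let ?X = "pure_tensor (?one[i := var1]) v"
  have "map_slot i ?t ?X - map_slot j ?t ?X = pure_tensor (?one[i := var1 - 1]) v - ?X"
    using ij t1 ts up2 by (simp add: t)
  also have "\<dots> = - pure_tensor ?one v"
    using ij up[of i] by (simp add: linearC_diff[OF multilinear_pure(1)])
  finally have "?X \<notin> U" using pure_ones_ne_0[OF v, of r] by (auto simp: U_def)
  moreover have "?X \<in> tensor_space r" by (rule pure_in_tensor_space) simp
  moreover assume "simple_gca_module (tensor_space r) T"
  ultimately show False using sub U0 unfolding simple_gca_module_def by blast
qed

lemma submodule_eq_tensor_space:
  assumes dist: "inj_on (\<lambda>k. lams ! k) {..<r}" and restr: "restricted_gca_module UNIV act"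
    and simp: "simple_gca_module UNIV act"
    and U: "gca_submodule U (tensor_space r) T" and ne: "U \<noteq> {0}"
  shows "U = tensor_space r"
proof -
  have Us: "cvs.subspace U" and UT: "U \<subseteq> tensor_space r" and Uact: "\<And>x X. X \<in> U \<Longrightarrow> T x X \<in> U"
    using U by (auto simp: gca_submodule_def)
  \<comment> \<open>Separate the contributions of the factors to \<open>T (g n)\<close>, first for large \<open>n\<close>.\<close>
  have slot_stable: "map_slot k (rho k (basis_vec (g n))) X \<in> U"
    if g: "g \<in> {gL, gH, gI, gJ}" and k: "k < r" and XU: "X \<in> U" for g k n X
  proof -
    have X: "X \<in> tensor_space r" using XU UT by blast
    define p where "p k n = (lams ! k powi (- n)) *\<^sub>C map_slot k (rho k (basis_vec (g n))) X" for k n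
    have unp: "(lams ! k powi n) *\<^sub>C p k n = map_slot k (rho k (basis_vec (g n))) X" if "k < r" for k n
      using lam_ne[OF that] by (simp add: p_def power_int_minus scaleC_one)
    obtain N where N: "\<And>n. n \<ge> N \<Longrightarrow> map_last (act (basis_vec (g n))) X = 0"
    proof -
      have "\<exists>N. \<forall>n\<ge>N. map_last (act (basis_vec (g n))) X = 0"
        using X
      proof (induction rule: tensor_space_induct)
        case zero
        then show ?case by (simp add: linearC_0[OF linearC_map_last[OF linearC_act]])
      next
        case (pure ps v)
        obtain i where i: "\<forall>n\<ge>int i. \<forall>x\<in>gca_component n. act x v = 0"
          using restr unfolding restricted_gca_module_def by blast
        have "basis_vec (g n) \<in> gca_component n" for n
          unfolding gca_component_def using g by (intro cvs.span_base) auto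
        with i have "\<forall>n\<ge>int i. map_last (act (basis_vec (g n))) (pure_tensor ps v) = 0"
          by (simp add: linearC_act linearC_0[OF multilinear_pure(2)])
        then show ?case by blast
      next
        case (add X Y)
        then obtain N N' where "\<forall>n\<ge>N. map_last (act (basis_vec (g n))) X = 0"
          "\<forall>n\<ge>N'. map_last (act (basis_vec (g n))) Y = 0" by blast
        then have "\<forall>n\<ge>max N N'. map_last (act (basis_vec (g n))) (X + Y) = 0"
          by (simp add: linearC_add[OF linearC_map_last[OF linearC_act]])
        then show ?case by blast
      qed
      then show ?thesis using that by blast
    qed
    have "p k n \<in> U"
    proof (rule exponential_separation[OF Us finite_lessThan dist, of p N])
      fix k assume "k \<in> {..<r}"
      then have k: "k < r" by simp
      show "lams ! k \<noteq> 0" by (rule lam_ne[OF k])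
      have seq: "poly_seq (\<lambda>n. (lams ! k powi (- n)) *\<^sub>C rho k (basis_vec (g n)) f)" for f
        unfolding rho_def by (rule poly_seq_factor_act[OF lam_ne[OF k] g])
      show "poly_seq (p k)"
        unfolding p_def using X
      proof (induction rule: tensor_space_induct)
        case zero
        then show ?case by (simp add: linearC_0[OF linearC_map_slot[OF linearC_rho]] poly_seq_const)
      next
        case (pure ps v)
        have "poly_seq (\<lambda>n. pure_tensor (ps[k := (lams ! k powi (- n)) *\<^sub>C rho k (basis_vec (g n)) (ps ! k)]) v)"
          by (rule poly_seq_linear[OF multilinear_pure(1) seq]) (simp add: k pure)
        then show ?case
          using k pure by (simp add: linearC_rho linearC_scale[OF multilinear_pure(1)])
      next
        case (add X Y)
        then show ?case
          by (simp add: linearC_add[OF linearC_map_slot[OF linearC_rho]] scaleC_add_right poly_seq_add)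
      qed
    next
      fix n assume "n \<ge> N"
      then have "T (basis_vec (g n)) X = (\<Sum>k<r. (lams ! k powi n) *\<^sub>C p k n)"
        by (simp add: T_eq_slots[OF X] N unp)
      then show "(\<Sum>k<r. (lams ! k powi n) *\<^sub>C p k n) \<in> U"
        using Uact[OF XU, of "basis_vec (g n)"] by simp
    qed (use k in simp)
    then have "(lams ! k powi n) *\<^sub>C p k n \<in> U" by (rule cvs.subspace_scale[OF Us])
    then show ?thesis by (simp add: unp[OF k])
  qed
  have slot: "map_slot k (rho k (basis_vec b)) X \<in> U" if "k < r" "X \<in> U" for k b X
    by (cases b) (use slot_stable[OF _ that] in auto)
  have last: "map_last (act (basis_vec b)) X \<in> U" if "X \<in> U" for b X
  proof -
    have "T (basis_vec b) X - (\<Sum>k<r. map_slot k (rho k (basis_vec b)) X) \<in> U"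
      using that by (intro cvs.subspace_diff[OF Us] cvs.subspace_sum[OF Us] slot Uact) auto
    then show ?thesis using that UT by (auto simp: T_eq_slots)
  qed
  have var_stable: "map_slot k (\<lambda>f. var1 * f) X \<in> U" "map_slot k (\<lambda>f. var2 * f) X \<in> U"
    if "k < r" "X \<in> U" for k X
  proof -
    have "rho k (basis_vec (gL 0)) = (\<lambda>f. var1 * f)" "rho k (basis_vec (gH 0)) = (\<lambda>f. var2 * f)"
      by (simp_all add: fun_eq_iff rho_def factor_act_basis scaleC_one)
    then show "map_slot k (\<lambda>f. var1 * f) X \<in> U" "map_slot k (\<lambda>f. var2 * f) X \<in> U"
      using slot[OF that, of "gL 0"] slot[OF that, of "gH 0"] by simp_all
  qed
  have diff_stable: "map_slot k (shift_diff (- of_int n) (factor_sign (k < m1))) X \<in> U"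
    if k: "k < r" and XU: "X \<in> U" for k n X
  proof -
    have X: "X \<in> tensor_space r" using XU UT by blast
    obtain b where b: "\<And>f. shift2 (- of_int n) (factor_sign (k < m1)) f
       = inverse (lams ! k powi n * sigs ! k) *\<^sub>C rho k (basis_vec b) f"
      using factor_act_shift[OF lam_ne[OF k] sig_ne[OF k], of n "k < m1" "etas ! k"]
      unfolding rho_def by blast
    have "map_slot k (shift_diff (- of_int n) (factor_sign (k < m1))) X =
        inverse (lams ! k powi n * sigs ! k) *\<^sub>C map_slot k (rho k (basis_vec b)) X - X"
      unfolding shift_diff_def[abs_def] b
      by (subst map_slot_diff[OF linearC_comp[OF linearC_scaleC linearC_rho] _ k X])
         (simp_all add: linearC_def[of "\<lambda>p. p"] map_slot_scale[OF linearC_rho k X] map_slot_id[OF X])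
    then show ?thesis
      using XU by (simp add: cvs.subspace_diff[OF Us] cvs.subspace_scale[OF Us] slot[OF k])
  qed
  let ?E = "\<lambda>k. map_slot k const_part :: (complex poly poly, 'v) tensor \<Rightarrow> _"
  \<comment> \<open>Make a vector of \<open>U\<close> constant in one slot after the other.\<close>
  have lowest: "\<exists>X\<in>U. X \<noteq> 0 \<and> (\<forall>k<j. ?E k X = X)" if "j \<le> r" for j
    using that
  proof (induction j)
    case 0
    then show ?case using ne cvs.subspace_0[OF Us] by auto
  next
    case (Suc j)
    then have j: "j < r" by simp
    define e where "e = factor_sign (j < m1)"
    have e: "e \<noteq> 0" by (simp add: e_def factor_sign_def)
    define S where "S = {X \<in> U. \<forall>k<j. ?E k X = X}"
    have SU: "X \<in> U" "X \<in> tensor_space r" if "X \<in> S" for X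
      using that UT by (auto simp: S_def)
    have S: "map_slot j (shift_diff (- of_int n) e) X \<in> S" if "X \<in> S" for n X
    proof -
      have "?E k (map_slot j (shift_diff (- of_int n) e) X) = map_slot j (shift_diff (- of_int n) e) X"
        if "k < j" for k
        using map_slot_commute[OF linearC_const_part linearC_shift_diff _ SU(2)[OF \<open>X \<in> S\<close>], of k j] that
          \<open>X \<in> S\<close> by (simp add: S_def)
      then show ?thesis
        using diff_stable[OF j SU(1)[OF that]] by (simp add: S_def e_def)
    qed
    obtain X0 where X0: "X0 \<in> S" "X0 \<noteq> 0" using Suc by (auto simp: S_def)
    have nil: "\<exists>d. (map_slot j (shift_diff a e) ^^ d) X = 0" if "X \<in> S" for a X
      by (rule map_slot_nilpotent[OF linearC_shift_diff shift_diff_nilpotent j SU(2)[OF that]])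
    obtain X1 where X1: "X1 \<in> S" "X1 \<noteq> 0" "map_slot j (shift_diff (-1) e) X1 = 0"
      using nilpotent_kernel[of S "map_slot j (shift_diff (-1) e)" X0] S[of _ 1] X0 nil by auto
    define S' where "S' = {X \<in> S. map_slot j (shift_diff (-1) e) X = 0}"
    have S': "map_slot j (shift_diff 0 e) X \<in> S'" if "X \<in> S'" for X
    proof -
      have X: "X \<in> S" "X \<in> tensor_space r" using that SU by (auto simp: S'_def)
      have c: "shift_diff (-1) e (shift_diff 0 e f) = shift_diff 0 e (shift_diff (-1) e f)" for f
        by (rule eval2_eqI) (simp add: shift_diff_def)
      have "map_slot j (shift_diff (-1) e) (map_slot j (shift_diff 0 e) X)
          = map_slot j (shift_diff 0 e) (map_slot j (shift_diff (-1) e) X)"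
        unfolding map_slot_comp[OF linearC_shift_diff linearC_shift_diff j X(2)] c ..
      then show ?thesis
        using that S[OF X(1), of 0] by (simp add: S'_def linearC_0[OF linearC_map_slot[OF linearC_shift_diff]])
    qed
    obtain X where X: "X \<in> S'" "X \<noteq> 0" "map_slot j (shift_diff 0 e) X = 0"
      using nilpotent_kernel[of S' "map_slot j (shift_diff 0 e)" X1] S' X1 nil by (auto simp: S'_def)
    have XT: "X \<in> tensor_space r" using X(1) SU by (auto simp: S'_def)
    obtain A B where AB: "linearC A" "linearC B"
      "\<And>f. f - const_part f = A (shift_diff (-1) e f) + B (shift_diff 0 e f)"
      using shift_diff_left_inverse[OF e] by blast
    have id: "linearC (\<lambda>p :: complex poly poly. p)" by (simp add: linearC_def)
    have "X - ?E j X = map_slot j (\<lambda>f. f - const_part f) X"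
      by (simp add: map_slot_diff[OF id linearC_const_part j XT] map_slot_id[OF XT])
    also have "\<dots> = map_slot j A (map_slot j (shift_diff (-1) e) X) + map_slot j B (map_slot j (shift_diff 0 e) X)"
      unfolding AB(3) map_slot_comp[OF AB(1) linearC_shift_diff j XT] map_slot_comp[OF AB(2) linearC_shift_diff j XT]
      by (rule map_slot_add[OF linearC_comp[OF AB(1) linearC_shift_diff]
            linearC_comp[OF AB(2) linearC_shift_diff] j XT])
    also have "\<dots> = 0"
      using X by (simp add: S'_def linearC_0[OF linearC_map_slot[OF AB(1)]] linearC_0[OF linearC_map_slot[OF AB(2)]])
    finally have "?E j X = X" by simp
    then have "\<forall>k<Suc j. ?E k X = X" using X(1) by (auto simp: S'_def S_def less_Suc_eq)
    then show ?case using X SU by (auto simp: S'_def)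
  qed
  let ?one = "replicate r (1 :: complex poly poly)"
  obtain Z where Z: "Z \<in> U" "Z \<noteq> 0" "\<And>k. k < r \<Longrightarrow> ?E k Z = Z" using lowest[of r] by blast
  \<comment> \<open>Constancy in every slot leaves only the tensors \<open>1 \<otimes> \<dots> \<otimes> 1 \<otimes> v\<close>.\<close>
  have Zspan: "Z \<in> cvs.span {pure_tensor ps v |ps v. length ps = r \<and> (\<forall>k<j. ps ! k = 1)}" if "j \<le> r" for j
    using that
  proof (induction j)
    case 0
    then show ?case using Z(1) UT by (auto simp: tensor_space_def)
  next
    case (Suc j)
    then have j: "j < r" by simp
    let ?W = "cvs.span {pure_tensor ps v |ps v. length ps = r \<and> (\<forall>k<Suc j. ps ! k = 1)}
      :: (complex poly poly, 'v) tensor set"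
    note El = linearC_map_slot[OF linearC_const_part]
    have "Z \<in> cvs.span {pure_tensor ps v |ps v. length ps = r \<and> (\<forall>k<j. ps ! k = 1)}"
      using Suc by simp
    then have "?E j Z \<in> ?W"
    proof (induction rule: cvs.span_induct_alt)
      case base
      then show ?case by (simp add: linearC_0[OF El] cvs.span_zero)
    next
      case (step c X Y)
      then obtain ps v where ps: "X = pure_tensor ps v" "length ps = r" "\<forall>k<j. ps ! k = 1" by blast
      have "pure_tensor (ps[j := 1]) v \<in> ?W"
        using ps j by (intro cvs.span_base) (auto simp: less_Suc_eq nth_list_update)
      then have "?E j X \<in> ?W"
        using j ps by (simp add: linearC_const_part const_part_def linearC_scale[OF multilinear_pure(1)] cvs.span_scale)
      then show ?case
        using step by (simp add: linearC_add[OF El] linearC_scale[OF El] cvs.span_add cvs.span_scale)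
    qed
    then show ?case using Z(3)[OF j] by simp
  qed
  have "{pure_tensor ps v |ps v. length ps = r \<and> (\<forall>k<r. ps ! k = 1)} = range (pure_tensor ?one :: 'v \<Rightarrow> _)"
  proof -
    have "length ps = r \<and> (\<forall>k<r. ps ! k = 1) \<longleftrightarrow> ps = ?one" for ps :: "complex poly poly list"
      by (auto intro: nth_equalityI)
    then show ?thesis by auto
  qed
  moreover have "cvs.subspace (range (pure_tensor ?one :: 'v \<Rightarrow> _))"
    unfolding cvs.subspace_def
    by (auto simp: linearC_0[OF multilinear_pure(2)] simp flip: linearC_add[OF multilinear_pure(2)]
        linearC_scale[OF multilinear_pure(2)] intro: range_eqI[of _ _ 0])
  ultimately obtain v where v: "Z = pure_tensor ?one v"
    using Zspan[of r] by (auto simp: cvs.span_eq_iff[THEN iffD2])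
  define V where "V = {v. pure_tensor ?one v \<in> U}"
  have "gca_submodule V UNIV act"
  proof (rule gca_submodule_basisI[OF V_module])
    show "cvs.subspace V"
      unfolding V_def cvs.subspace_def
      by (auto simp: linearC_0[OF multilinear_pure(2)] linearC_add[OF multilinear_pure(2)]
          linearC_scale[OF multilinear_pure(2)] cvs.subspace_0[OF Us] cvs.subspace_add[OF Us]
          cvs.subspace_scale[OF Us])
    show "act (basis_vec b) u \<in> V" if "u \<in> V" for b u
      using that last[of "pure_tensor ?one u" b] by (simp add: V_def linearC_act)
  qed simp
  moreover have "v \<in> V" "v \<noteq> 0"
    using Z v by (auto simp: V_def linearC_0[OF multilinear_pure(2)])
  ultimately have VU: "V = UNIV"
    using simp unfolding simple_gca_module_def by blast
  \<comment> \<open>Fill the slots from the left, by multiplication with the variables.\<close>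
  have all: "pure_tensor ps v \<in> U"
    if "j \<le> r" "length ps = r" "\<forall>k<r. k \<ge> j \<longrightarrow> ps ! k = 1" for j ps v
    using that
  proof (induction j arbitrary: ps)
    case 0
    then have "ps = ?one" by (auto intro: nth_equalityI)
    then show ?case using VU by (auto simp: V_def)
  next
    case (Suc j)
    then have j: "j < r" by simp
    have lin: "linearC (\<lambda>p. pure_tensor (ps[j := p]) v)"
      by (rule multilinear_pure(1)) (use Suc j in simp)
    have "pure_tensor (ps[j := p]) v \<in> U" for p
    proof (induction p rule: poly2_induct)
      case one
      show ?case by (rule Suc.IH) (use Suc.prems in \<open>auto simp: nth_list_update Suc_le_eq\<close>)
    next
      case (add f g)
      then show ?case by (simp add: linearC_add[OF lin] cvs.subspace_add[OF Us])
    next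
      case (scale c f)
      then show ?case by (simp add: linearC_scale[OF lin] cvs.subspace_scale[OF Us])
    next
      case (var1 f)
      then show ?case using var_stable(1)[OF j var1] j Suc.prems by (simp add: linearC_times)
    next
      case (var2 f)
      then show ?case using var_stable(2)[OF j var2] j Suc.prems by (simp add: linearC_times)
    qed
    from this[of "ps ! j"] show ?case by simp
  qed
  have "tensor_space r \<subseteq> U"
    unfolding tensor_space_def by (rule cvs.span_minimal[OF _ Us]) (use all[of r] in auto)
  with UT show ?thesis by blast
qed

end

theorem theorem3p3:
  fixes m1 m2 :: nat and lams sigs etas :: "complex list"
    and act :: "gca \<Rightarrow> 'v::complex_vector \<Rightarrow> 'v"
  assumes "length lams = m1 + m2" and "length sigs = m1 + m2" and "length etas = m1 + m2"
    and "0 \<notin> set lams" and "0 \<notin> set sigs"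
    and "simple_gca_module (UNIV :: 'v set) act"
    and "restricted_gca_module (UNIV :: 'v set) act"
  shows "simple_gca_module (tensor_space (m1 + m2)) (T_act m1 lams sigs etas act)
           \<longleftrightarrow> distinct lams"
proof -
  let ?r = "m1 + m2"
  have V: "gca_module UNIV act" and V0: "(UNIV :: 'v set) \<noteq> {0}"
    using assms(6) by (auto simp: simple_gca_module_def)
  interpret mixed_tensor m1 ?r lams sigs etas act
  proof (rule mixed_tensor.intro)
    show "lams ! k \<noteq> 0" "sigs ! k \<noteq> 0" if "k < ?r" for k
      using that assms(1,2,4,5) by (metis nth_mem)+
  qed (fact V T_module[OF assms(1,4) V])+
  show ?thesis
  proof
    assume "simple_gca_module (tensor_space ?r) (T_act m1 lams sigs etas act)"
    then show "distinct lams"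
      unfolding distinct_conv_nth using not_simple_if_repeated[OF _ _ _ _ V0] assms(1) by metis
  next
    assume "distinct lams"
    then have inj: "inj_on (\<lambda>k. lams ! k) {..<?r}"
      using assms(1) by (auto simp: inj_on_def nth_eq_iff_index_eq)
    obtain v :: 'v where "v \<noteq> 0" using V0 by auto
    then have "pure_tensor (replicate ?r (1 :: complex poly poly)) v \<noteq> 0" by (rule pure_ones_ne_0)
    moreover have "pure_tensor (replicate ?r (1 :: complex poly poly)) v \<in> tensor_space ?r"
      by (simp add: pure_in_tensor_space)
    ultimately have "tensor_space ?r \<noteq> ({0} :: (complex poly poly, 'v) tensor set)" by blast
    then show "simple_gca_module (tensor_space ?r) (T_act m1 lams sigs etas act)"
      unfolding simple_gca_module_def
      using T_is_module submodule_eq_tensor_space[OF inj assms(7,6)] by blast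
  qed
qed

end
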